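(* Let $\Gamma$ be a group (under composition) of orientation-preserving $C^2$ diffeomorphisms of the circle $\mathbb{S}^1$. The projective cocycle $P$ over the action of $\Gamma$ on $\mathbb{S}^1$ is $\mathrm{SO}(2,\mathbb{R})$-reducible if and only if the action of $\Gamma$ is $C^2$ conjugate to an action by rotations, that is, if and only if there exists an orientation-preserving $C^2$ diffeomorphism $\varphi$ of $\mathbb{S}^1$ such that $\varphi\circ f\circ\varphi^{-1}$ is a rotation for every $f\in\Gamma$.
   Context: The circle $\mathbb{S}^1$ is identified with $\mathbb{R}/2\pi\mathbb{Z}$ via $\theta\mapsto e^{i\theta}$. Derivatives $Df, D^2f$ of circle maps are taken with respect to the angle coordinate $\theta$ (via lifts to $\mathbb{R}$). All maps are orientation preserving. A $C^2$ diffeomorphism is a $C^2$ bijection with $C^2$ inverse. $\mathcal{M}$ denotes the group of Möbius transformations of the circle, i.e. the maps $z\mapsto e^{i\kappa}\,\frac{z-\sigma}{1-\bar\sigma z}$ of $\{|z|=1\}$ with $\kappa\in\mathbb{R}$ and $\sigma\in\mathbb{C}$, $|\sigma|<1$; it is identified with $\mathrm{PSL}(2,\mathbb{R})$ as a topological group. The subgroup of rotations $z\mapsto e^{i\kappa}z$ (the case $\sigma=0$) is denoted $\mathrm{SO}(2,\mathbb{R})$. Projective derivative: for a $C^2$ circle diffeomorphism $f$ and $\theta\in\mathbb{S}^1$, $P_{f,\theta}\in\mathcal{M}$ is the unique Möbius transformation $P$ of the circle with $P(\theta)=f(\theta)$, $DP(\theta)=Df(\theta)$ and $D^2P(\theta)=D^2f(\theta)$.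 It satisfies the cocycle relation $P_{f,g(\theta)}\circ P_{g,\theta}=P_{fg,\theta}$. For a group $\Gamma$ of $C^2$ circle diffeomorphisms, the projective cocycle is the map $(f,\theta)\mapsto P_{f,\theta}$ for $f\in\Gamma$, $\theta\in\mathbb{S}^1$. The projective cocycle over $\Gamma$ is $\mathrm{SO}(2,\mathbb{R})$-reducible if there is a continuous map $B:\mathbb{S}^1\to\mathcal{M}$ such that $B(f(\theta))\circ P_{f,\theta}\circ B(\theta)^{-1}$ is a rotation for every $\theta\in\mathbb{S}^1$ and every $f\in\Gamma$. *)

theory Defs
  imports "HOL-Complex_Analysis.Complex_Analysis" "HOL-Algebra.Bij"
begin

text \<open>
  The circle \<open>\<real>/2\<pi>\<int>\<close> is the unit circle of the complex plane, the angle \<open>t\<close> corresponding to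
  \<open>cis t\<close>. Bijections of the circle are extensional functions, that is, elements of
  \<open>BijGroup circle\<close>, whose multiplication is composition.
\<close>

abbreviation circle :: "complex set" where
  "circle \<equiv> sphere 0 1"


subsection \<open>Lifts and derivatives in the angle coordinate\<close>

definition is_lift :: "(real \<Rightarrow> real) \<Rightarrow> (complex \<Rightarrow> complex) \<Rightarrow> bool" where
  "is_lift F f \<longleftrightarrow> continuous_on UNIV F \<and> (\<forall>t. cis (F t) = f (cis t))"

text \<open>
  The value does not depend on the lift, nor on the angle representing the point; see
  \<open>circle_deriv_eq\<close> and \<open>circle_deriv2_eq\<close> below.
\<close>

definition circle_deriv :: "(complex \<Rightarrow> complex) \<Rightarrow> complex \<Rightarrow> real" where
  "circle_deriv f z = deriv (SOME F. is_lift F f) (Arg z)"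

definition circle_deriv2 :: "(complex \<Rightarrow> complex) \<Rightarrow> complex \<Rightarrow> real" where
  "circle_deriv2 f z = deriv (deriv (SOME F. is_lift F f)) (Arg z)"

definition circle_C2 :: "(complex \<Rightarrow> complex) \<Rightarrow> bool" where
  "circle_C2 f \<longleftrightarrow> (\<exists>F F' F''. is_lift F f
     \<and> (\<forall>t. (F has_real_derivative F' t) (at t))
     \<and> (\<forall>t. (F' has_real_derivative F'' t) (at t))
     \<and> continuous_on UNIV F'')"

definition orientation_preserving :: "(complex \<Rightarrow> complex) \<Rightarrow> bool" where
  "orientation_preserving f \<longleftrightarrow> (\<exists>F. is_lift F f \<and> strict_mono F)"

definition circle_diffeos :: "(complex \<Rightarrow> complex) set" where
  "circle_diffeos = {f \<in> Bij circle. circle_C2 f \<and> circle_C2 (inv\<^bsub>BijGroup circle\<^esub> f)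
     \<and> orientation_preserving f}"

lemma cis_eqD:
  assumes "cis s = cis t"
  shows "\<exists>n::int. s = t + 2 * pi * n"
  using assms sin_cos_eq_iff[of s t] by (simp add: complex_eq_iff)

lemma is_lift_diff_const:
  assumes "is_lift F f" "is_lift G f"
  shows "\<exists>c. \<forall>t. F t = G t + c"
proof -
  have int: "\<exists>k::int. F t - G t = 2 * pi * k" for t
  proof -
    have "cis (F t) = cis (G t)"
      using assms by (simp add: is_lift_def)
    then obtain n :: int where "F t = G t + 2 * pi * n"
      using cis_eqD by blast
    then show ?thesis by auto
  qed
  have "(\<lambda>t. F t - G t) constant_on UNIV"
  proof (rule continuous_discrete_range_constant)
    show "continuous_on UNIV (\<lambda>t. F t - G t)"
      using assms by (auto simp: is_lift_def intro: continuous_intros)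
    fix x
    show "\<exists>e>0. \<forall>y. y \<in> UNIV \<and> F y - G y \<noteq> F x - G x
             \<longrightarrow> e \<le> norm ((F y - G y) - (F x - G x))"
    proof (intro exI[of _ "2 * pi"] conjI allI impI)
      fix y assume ne: "y \<in> UNIV \<and> F y - G y \<noteq> F x - G x"
      obtain k l :: int where kl: "F y - G y = 2 * pi * k" "F x - G x = 2 * pi * l"
        using int by meson
      with ne have "k \<noteq> l" by auto
      then have "1 \<le> \<bar>real_of_int (k - l)\<bar>" by linarith
      moreover have "norm ((F y - G y) - (F x - G x)) = 2 * pi * \<bar>real_of_int (k - l)\<bar>"
        unfolding kl by (simp add: abs_mult flip: right_diff_distrib)
      ultimately show "2 * pi \<le> norm ((F y - G y) - (F x - G x))"
        by (simp add: mult_le_cancel_left1)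
    qed simp
  qed auto
  then obtain c where "\<And>t. F t - G t = c"
    by (auto simp: constant_on_def)
  then have "\<forall>t. F t = G t + c" by (metis diff_add_cancel add.commute)
  then show ?thesis ..
qed

lemma deriv_shift_gen:
  fixes F G :: "real \<Rightarrow> real"
  assumes "\<And>t. F (t + a) = G t + c"
  shows "deriv F (t + a) = deriv G t"
proof -
  have G: "G = (\<lambda>t. F (t + a) - c)" by (simp add: assms)
  have "(F has_real_derivative D) (at (t + a)) \<longleftrightarrow> (G has_real_derivative D) (at t)" for D
  proof
    assume "(F has_real_derivative D) (at (t + a))"
    then show "(G has_real_derivative D) (at t)"
      unfolding G using DERIV_diff[OF _ DERIV_const[of c]] DERIV_shift[of F D t a] by fastforce
  next
    assume "(G has_real_derivative D) (at t)"
    then have "((\<lambda>t. G t + c) has_real_derivative D) (at t)"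
      using DERIV_add[OF _ DERIV_const[of c]] by fastforce
    then have "((\<lambda>t. F (t + a)) has_real_derivative D) (at t)"
      by (simp only: assms)
    then show "(F has_real_derivative D) (at (t + a))"
      by (simp only: DERIV_shift)
  qed
  then show ?thesis by (simp add: deriv_def)
qed

lemma deriv_lift_unique:
  assumes "is_lift F f" "is_lift G f" "cis s = cis t"
  shows "deriv F s = deriv G t" "deriv (deriv F) s = deriv (deriv G) t"
proof -
  obtain n :: int where n: "s = t + 2 * pi * n"
    using assms(3) using cis_eqD by blast
  have per: "cis (x + 2 * pi * n) = cis x" for x
    by (simp add: cis_mult[symmetric] cis_multiple_2pi)
  have "is_lift (\<lambda>x. F (x + 2 * pi * n)) f"
    using assms(1) per unfolding is_lift_def
    by (auto intro!: continuous_on_compose2[of UNIV F] continuous_intros)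
  then obtain c where c: "F (x + 2 * pi * n) = G x + c" for x
    using is_lift_diff_const[OF _ assms(2)] by blast
  have d: "deriv F (x + 2 * pi * n) = deriv G x" for x
    using deriv_shift_gen[of F "2 * pi * n" G c] c by simp
  show "deriv F s = deriv G t" using d n by simp
  show "deriv (deriv F) s = deriv (deriv G) t"
    using deriv_shift_gen[of "deriv F" "2 * pi * n" "deriv G" 0] d n by simp
qed

lemma circle_deriv_eq:
  assumes "is_lift F f"
  shows "circle_deriv f (cis t) = deriv F t"
  unfolding circle_deriv_def
  by (rule deriv_lift_unique(1)[OF someI[of "\<lambda>F. is_lift F f", OF assms] assms])
     (simp add: cis_Arg sgn_div_norm)

lemma circle_deriv2_eq:
  assumes "is_lift F f"
  shows "circle_deriv2 f (cis t) = deriv (deriv F) t"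
  unfolding circle_deriv2_def
  by (rule deriv_lift_unique(2)[OF someI[of "\<lambda>F. is_lift F f", OF assms] assms])
     (simp add: cis_Arg sgn_div_norm)


subsection \<open>Moebius transformations of the circle\<close>

definition moebius_circle :: "(complex \<Rightarrow> complex) set" where
  "moebius_circle = {restrict (Moebius_function \<kappa> \<sigma>) circle | \<kappa> \<sigma>. norm \<sigma> < 1}"

definition rotations :: "(complex \<Rightarrow> complex) set" where
  "rotations = {restrict (\<lambda>z. cis \<kappa> * z) circle | \<kappa>. True}"

definition SL2R :: "(real^2^2) set" where
  "SL2R = {A. det A = 1}"

text \<open>
  A matrix in \<open>SL(2,\<real>)\<close> acts on \<open>\<real> \<union> {\<infinity>}\<close> by \<open>x \<mapsto> (a x + b) / (c x + d)\<close>. Conjugating with the Cayley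
  transform \<open>x \<mapsto> (x - \<i>) / (x + \<i>)\<close> turns this into the following action on the circle. By
  \<open>SL2R_action_image\<close> and \<open>SL2R_action_eq_iff\<close> below it identifies \<open>moebius_circle\<close> with
  \<open>PSL(2,\<real>) = SL(2,\<real>) / {\<plusminus>1}\<close>, and \<open>moebius_circle\<close> is given the corresponding quotient topology.
\<close>

definition SL2R_alpha :: "real^2^2 \<Rightarrow> complex" where
  "SL2R_alpha A = Complex ((A$1$1 + A$2$2) / 2) ((A$1$2 - A$2$1) / 2)"

definition SL2R_beta :: "real^2^2 \<Rightarrow> complex" where
  "SL2R_beta A = Complex ((A$1$1 - A$2$2) / 2) (- (A$1$2 + A$2$1) / 2)"

definition SL2R_action :: "real^2^2 \<Rightarrow> complex \<Rightarrow> complex" where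
  "SL2R_action A = restrict (\<lambda>z. (SL2R_alpha A * z + SL2R_beta A) /
     (cnj (SL2R_beta A) * z + cnj (SL2R_alpha A))) circle"

definition moebius_topology :: "(complex \<Rightarrow> complex) topology" where
  "moebius_topology = topology (\<lambda>U. U \<subseteq> moebius_circle \<and>
     openin (top_of_set SL2R) {A \<in> SL2R. SL2R_action A \<in> U})"

lemma det_alpha_beta: "det A = (norm (SL2R_alpha A))\<^sup>2 - (norm (SL2R_beta A))\<^sup>2"
proof -
  have "p * s - q * r = (((p + s) / 2)\<^sup>2 + ((q - r) / 2)\<^sup>2) - (((p - s) / 2)\<^sup>2 + (- (q + r) / 2)\<^sup>2)"
    for p q r s :: real
  proof -
    have "4 * (p * s - q * r) = (p + s)\<^sup>2 + (q - r)\<^sup>2 - (p - s)\<^sup>2 - (- (q + r))\<^sup>2"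
      by algebra
    then show ?thesis
      unfolding power_divide by simp
  qed
  then show ?thesis
    unfolding SL2R_alpha_def SL2R_beta_def det_2 cmod_power2 complex.sel .
qed

lemma alpha_beta_surj: "\<exists>A. SL2R_alpha A = a \<and> SL2R_beta A = b"
proof -
  define A :: "real^2^2" where
    "A = vector [vector [Re a + Re b, Im a - Im b], vector [- Im a - Im b, Re a - Re b]]"
  have "A$1$1 = Re a + Re b" "A$1$2 = Im a - Im b" "A$2$1 = - Im a - Im b" "A$2$2 = Re a - Re b"
    unfolding A_def by (simp_all only: vector_2)
  then have "SL2R_alpha A = a \<and> SL2R_beta A = b"
    unfolding SL2R_alpha_def SL2R_beta_def complex_eq_iff complex.sel by argo
  then show ?thesis by (rule exI)
qed

lemma alpha_beta_inj:
  assumes "SL2R_alpha A = SL2R_alpha B" "SL2R_beta A = SL2R_beta B"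
  shows "A = B"
proof -
  have two: "(2::real) \<noteq> 0" by simp
  have "A$1$1 + A$2$2 = B$1$1 + B$2$2" "A$1$2 - A$2$1 = B$1$2 - B$2$1"
    "A$1$1 - A$2$2 = B$1$1 - B$2$2" "A$1$2 + A$2$1 = B$1$2 + B$2$1"
    using assms two
    unfolding SL2R_alpha_def SL2R_beta_def complex.inject divide_cancel_right neg_equal_iff_equal
    by blast+
  then have "A$1$1 = B$1$1" "A$1$2 = B$1$2" "A$2$1 = B$2$1" "A$2$2 = B$2$2"
    by linarith+
  then show ?thesis
    by (simp add: vec_eq_iff forall_2)
qed

lemma alpha_uminus: "SL2R_alpha (- A) = - SL2R_alpha A"
  and beta_uminus: "SL2R_beta (- A) = - SL2R_beta A"
  unfolding SL2R_alpha_def SL2R_beta_def complex_eq_iff complex.sel uminus_complex.sel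
    vector_uminus_component by argo+

lemma SL2R_denominator_nz:
  assumes "A \<in> SL2R" "z \<in> circle"
  shows "cnj (SL2R_beta A) * z + cnj (SL2R_alpha A) \<noteq> 0"
proof
  assume "cnj (SL2R_beta A) * z + cnj (SL2R_alpha A) = 0"
  then have "cnj (SL2R_alpha A) = - (cnj (SL2R_beta A) * z)"
    by (simp add: add_eq_0_iff)
  then have "norm (cnj (SL2R_alpha A)) = norm (- (cnj (SL2R_beta A) * z))"
    by (rule arg_cong)
  then have "norm (SL2R_alpha A) = norm (SL2R_beta A)"
    using assms(2) by (simp add: norm_mult)
  then show False
    using assms(1) det_alpha_beta[of A] by (simp add: SL2R_def)
qed

lemma SL2R_action_image: "SL2R_action ` SL2R = moebius_circle"
proof (intro equalityI subsetI)
  fix f assume "f \<in> SL2R_action ` SL2R"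
  then obtain A where A: "A \<in> SL2R" "f = SL2R_action A" by blast
  define a b where "a = SL2R_alpha A" "b = SL2R_beta A"
  have ab: "(norm a)\<^sup>2 - (norm b)\<^sup>2 = 1"
    using A det_alpha_beta[of A] by (simp add: SL2R_def a_b_def)
  then have a0: "a \<noteq> 0" by (auto simp: power2_eq_square) (smt (verit) zero_le_square)
  have "norm b < norm a"
    using ab by (smt (verit) norm_ge_zero power_mono)
  then have s: "norm (- b / a) < 1" using a0 by (simp add: norm_divide)
  have pol: "a = norm a * cis (Arg a)" by (metis rcis_cmod_Arg rcis_def)
  have ex: "exp (\<i> * of_real (2 * Arg a)) = a / cnj a"
  proof -
    have "cnj a = norm a * cis (- Arg a)" using pol by (metis cis_cnj complex_cnj_mult complex_cnj_complex_of_real)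
    then have "a / cnj a = (norm a * cis (Arg a)) / (norm a * cis (- Arg a))"
      using pol by metis
    also have "\<dots> = cis (2 * Arg a)" using a0 by (simp add: cis_divide)
    finally show ?thesis by (simp add: cis_conv_exp)
  qed
  have "f = restrict (Moebius_function (2 * Arg a) (- b / a)) circle"
    unfolding A(2) SL2R_action_def Moebius_function_def ex a_b_def[symmetric]
  proof (rule restrict_ext)
    fix z assume z: "z \<in> circle"
    have d: "cnj b * z + cnj a \<noteq> 0"
      using SL2R_denominator_nz[OF A(1) z] by (simp add: a_b_def)
    have "a / cnj a * (z - - b / a) = (a * z + b) / cnj a" 
      using a0 by (simp add: field_simps)
    moreover have "1 - cnj (- b / a) * z = (cnj b * z + cnj a) / cnj a"
      using a0 by (simp add: field_simps)
    ultimately show "(a * z + b) / (cnj b * z + cnj a) =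
        a / cnj a * (z - - b / a) / (1 - cnj (- b / a) * z)"
      using a0 d by simp
  qed
  with s have "\<exists>\<kappa> \<sigma>. f = restrict (Moebius_function \<kappa> \<sigma>) circle \<and> norm \<sigma> < 1"
    by (intro exI[of _ "2 * Arg a"] exI[of _ "- b / a"] conjI)
  then show "f \<in> moebius_circle"
    by (simp only: moebius_circle_def mem_Collect_eq)
next
  fix f assume "f \<in> moebius_circle"
  then obtain k s where f: "f = restrict (Moebius_function k s) circle" and s: "norm s < 1"
    unfolding moebius_circle_def by blast
  define r where "r = 1 / sqrt (1 - (norm s)\<^sup>2)"
  have pos: "1 - (norm s)\<^sup>2 > 0" using s by (simp add: power_less_one_iff abs_square_less_1)
  then have r: "r > 0" "r\<^sup>2 * (1 - (norm s)\<^sup>2) = 1" by (simp_all add: r_def power_divide)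
  obtain A where A: "SL2R_alpha A = cis (k / 2) * r" "SL2R_beta A = - (cis (k / 2) * r * s)"
    using alpha_beta_surj by blast
  have "det A = 1"
    using r by (simp add: det_alpha_beta A norm_mult power_mult_distrib algebra_simps)
  moreover have "f = SL2R_action A"
    unfolding f SL2R_action_def
  proof (rule restrict_ext)
    fix z :: complex
    have c: "exp (\<i> * of_real k) = cis (k / 2) / cis (- (k / 2))"
      unfolding cis_divide by (simp add: cis_conv_exp)
    have "SL2R_alpha A * z + SL2R_beta A = r * (cis (k / 2) * (z - s))"
      by (simp add: A algebra_simps)
    moreover have "cnj (SL2R_beta A) * z + cnj (SL2R_alpha A) = r * (cis (- (k / 2)) * (1 - cnj s * z))"
      by (simp add: A cis_cnj algebra_simps)
    ultimately show "Moebius_function k s z = (SL2R_alpha A * z + SL2R_beta A) /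
        (cnj (SL2R_beta A) * z + cnj (SL2R_alpha A))"
      using r(1) by (simp add: Moebius_function_def c)
  qed
  ultimately show "f \<in> SL2R_action ` SL2R" by (auto simp: SL2R_def)
qed

lemma SL2R_action_eq_iff:
  assumes "A \<in> SL2R" "B \<in> SL2R"
  shows "SL2R_action A = SL2R_action B \<longleftrightarrow> B = A \<or> B = - A"
proof
  assume "B = A \<or> B = - A"
  then show "SL2R_action A = SL2R_action B"
  proof
    assume "B = - A"
    have "(- a * z + - b) / (- c * z + - d) = (a * z + b) / (c * z + d)" for a b c d z :: complex
      using minus_divide_divide[of "a * z + b" "c * z + d"] by simp
    then show ?thesis
      by (auto simp: SL2R_action_def \<open>B = - A\<close> alpha_uminus beta_uminus)
  qed simp
next
  assume eq: "SL2R_action A = SL2R_action B"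
  define a b c d where "a = SL2R_alpha A" "b = SL2R_beta A" "c = SL2R_alpha B" "d = SL2R_beta B"
  note defs = a_b_c_d_def
  have nrm: "a * cnj a - b * cnj b = 1" "c * cnj c - d * cnj d = 1"
    using assms det_alpha_beta[of A] det_alpha_beta[of B]
    by (simp_all add: SL2R_def defs complex_mult_cnj complex_eq_iff cmod_power2)
  have cross: "(a * z + b) * (cnj d * z + cnj c) = (c * z + d) * (cnj b * z + cnj a)"
    if z: "z \<in> circle" for z
  proof -
    have "(a * z + b) / (cnj b * z + cnj a) = (c * z + d) / (cnj d * z + cnj c)"
      using fun_cong[OF eq, of z] z by (simp add: SL2R_action_def defs)
    then show ?thesis
      using SL2R_denominator_nz[OF assms(1) z] SL2R_denominator_nz[OF assms(2) z]
      by (simp add: defs frac_eq_eq)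
  qed
  define X Y Z where "X = a * cnj d - c * cnj b" "Y = a * cnj c + b * cnj d - c * cnj a - d * cnj b"
    "Z = b * cnj c - d * cnj a"
  have poly: "X * z\<^sup>2 + Y * z + Z = 0" if "z \<in> circle" for z
    using cross[OF that] by (simp add: X_Y_Z_def algebra_simps power2_eq_square)
  have "X + Y + Z = 0" "X - Y + Z = 0" "- X + \<i> * Y + Z = 0"
    using poly[of 1] poly[of "-1"] poly[of \<i>] by (simp_all add: mult.commute)
  then have "Y = 0" "X + Z = 0" "Z - X = 0"
    by (auto simp: complex_eq_iff)
  then have XYZ: "X = 0" "Y = 0" "Z = 0" by (auto simp: complex_eq_iff)
  have a0: "a \<noteq> 0"
  proof
    assume "a = 0"
    moreover have "(norm a)\<^sup>2 - (norm b)\<^sup>2 = 1"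
      using assms(1) det_alpha_beta[of A] by (simp add: SL2R_def defs)
    ultimately have "- ((norm b)\<^sup>2) = 1" by simp
    then show False
      using zero_le_power2[of "norm b"] by linarith
  qed
  define l where "l = c / a"
  have c: "c = l * a" using a0 by (simp add: l_def)
  have "a * cnj d = a * (l * cnj b)" using XYZ(1) by (simp add: X_Y_Z_def c)
  then have "cnj d = l * cnj b" using a0 by simp
  then have d: "d = cnj l * b" by (metis complex_cnj_cnj complex_cnj_mult)
  have "(cnj l - l) * (a * cnj a - b * cnj b) = 0"
    using XYZ(2) by (simp add: X_Y_Z_def c d algebra_simps)
  then have l: "cnj l = l" by (simp add: nrm)
  have "l * l * (a * cnj a - b * cnj b) = 1"
    using nrm(2) unfolding c d complex_cnj_mult complex_cnj_cnj l by algebra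
  then have "l * l = 1" by (simp add: nrm)
  then have "l = 1 \<or> l = - 1" by (simp add: square_eq_1_iff)
  then show "B = A \<or> B = - A"
  proof
    assume "l = 1"
    then have "B = A" using c d by (intro alpha_beta_inj) (simp_all add: defs)
    then show ?thesis ..
  next
    assume "l = - 1"
    then have "B = - A"
      using c d by (intro alpha_beta_inj) (simp_all add: defs alpha_uminus beta_uminus)
    then show ?thesis ..
  qed
qed

lemma openin_moebius_topology:
  "openin moebius_topology U \<longleftrightarrow>
     U \<subseteq> moebius_circle \<and> openin (top_of_set SL2R) {A \<in> SL2R. SL2R_action A \<in> U}"
proof -
  have "istopology (\<lambda>U. U \<subseteq> moebius_circle \<and>
     openin (top_of_set SL2R) {A \<in> SL2R. SL2R_action A \<in> U})" (is "istopology ?P")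
    unfolding istopology_def
  proof (intro conjI allI impI)
    fix S T assume S: "?P S" and T: "?P T"
    show "S \<inter> T \<subseteq> moebius_circle" using S by blast
    have "{A \<in> SL2R. SL2R_action A \<in> S \<inter> T} =
        {A \<in> SL2R. SL2R_action A \<in> S} \<inter> {A \<in> SL2R. SL2R_action A \<in> T}" by blast
    then show "openin (top_of_set SL2R) {A \<in> SL2R. SL2R_action A \<in> S \<inter> T}"
      using S T by (metis (no_types, lifting) openin_Int)
  next
    fix K assume K: "\<forall>S\<in>K. ?P S"
    show "\<Union>K \<subseteq> moebius_circle" using K by blast
    have "{A \<in> SL2R. SL2R_action A \<in> \<Union>K} = \<Union>((\<lambda>S. {A \<in> SL2R. SL2R_action A \<in> S}) ` K)"
      by blast
    then show "openin (top_of_set SL2R) {A \<in> SL2R. SL2R_action A \<in> \<Union>K}"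
      using K by (smt (verit, best) imageE openin_Union)
  qed
  then show ?thesis by (simp add: moebius_topology_def topology_inverse')
qed

lemma topspace_moebius_topology: "topspace moebius_topology = moebius_circle"
proof -
  have "{A \<in> SL2R. SL2R_action A \<in> moebius_circle} = SL2R"
    using SL2R_action_image by blast
  then have "openin moebius_topology moebius_circle"
    by (simp add: openin_moebius_topology)
  then show ?thesis
    by (meson openin_moebius_topology openin_subset openin_topspace subset_antisym)
qed

lemma quotient_map_SL2R_action: "quotient_map (top_of_set SL2R) moebius_topology SL2R_action"
  by (simp add: quotient_map_def SL2R_action_image topspace_moebius_topology openin_moebius_topology)


subsection \<open>The projective cocycle\<close>

definition projective_derivative :: "(complex \<Rightarrow> complex) \<Rightarrow> complex \<Rightarrow> complex \<Rightarrow> complex" where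
  "projective_derivative f \<theta> = (THE P. P \<in> moebius_circle \<and> P \<theta> = f \<theta>
     \<and> circle_deriv P \<theta> = circle_deriv f \<theta> \<and> circle_deriv2 P \<theta> = circle_deriv2 f \<theta>)"

definition SO2_reducible :: "(complex \<Rightarrow> complex) set \<Rightarrow> bool" where
  "SO2_reducible \<Gamma> \<longleftrightarrow> (\<exists>B. continuous_map (top_of_set circle) moebius_topology B \<and>
     (\<forall>f\<in>\<Gamma>. \<forall>\<theta>\<in>circle.
        B (f \<theta>) \<otimes>\<^bsub>BijGroup circle\<^esub> projective_derivative f \<theta>
          \<otimes>\<^bsub>BijGroup circle\<^esub> inv\<^bsub>BijGroup circle\<^esub> (B \<theta>) \<in> rotations))"

definition C2_conjugate_to_rotations :: "(complex \<Rightarrow> complex) set \<Rightarrow> bool" where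
  "C2_conjugate_to_rotations \<Gamma> \<longleftrightarrow> (\<exists>\<phi>\<in>circle_diffeos. \<forall>f\<in>\<Gamma>.
     \<phi> \<otimes>\<^bsub>BijGroup circle\<^esub> f \<otimes>\<^bsub>BijGroup circle\<^esub> inv\<^bsub>BijGroup circle\<^esub> \<phi> \<in> rotations)"

end

theory Submission
  imports Defs
begin

text \<open>
  Two Moebius transformations differ by a rotation on the left exactly when they have the same first
  and second derivatives at one point of the circle (\<open>same_jet_rotation\<close>). So the only part of
  \<open>B(\<theta>)\<close> that matters for reducibility is the pair \<open>b(\<theta>) = D(B(\<theta>))(\<theta>) > 0\<close>,
  \<open>b2(\<theta>) = D\<^sup>2(B(\<theta>))(\<theta>)\<close>, and continuity of \<open>B\<close> can be traded for continuity
  of these two functions. As \<open>P\<^bsub>f,\<theta>\<^esub>\<close> has the 2-jet of \<open>f\<close> at \<open>\<theta>\<close>, the chain rule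
  turns the condition that \<open>B(f(\<theta>)) P\<^bsub>f,\<theta>\<^esub> B(\<theta>)\<^sup>-\<^sup>1\<close> is a rotation into the equations
  \<open>b(f) f' = b\<close> and \<open>b2(f) f'\<^sup>2 + b(f) f'' = b2\<close>
  (\<open>SO2_reducible_iff_jets\<close>): \<open>(b, b2)\<close> looks like the first two derivatives of a function that
  \<open>f\<close> preserves up to a constant.

  If \<open>\<phi>\<close> conjugates every \<open>f\<close> to a rotation, then \<open>(\<phi>', \<phi>'')\<close> is such a pair. This is
  the easy direction.

  Conversely, integrating the invariant density \<open>b\<close> gives a conjugacy to rotations, but only a
  \<open>C\<^sup>1\<close> one, because nothing says that \<open>b2\<close> is the derivative of \<open>b\<close>. The
  idea (\<open>jet_field_linearizes\<close>) is to recover a density from \<open>v = b2 / b\<close> instead. The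
  equations say \<open>v(f) f' + f'' / f' = v\<close>, which is the transformation rule of the logarithmic
  derivative of an invariant density, and they persist for \<open>e = v + a b\<close> with any constant \<open>a\<close>.
  Choose \<open>a\<close> so that \<open>e\<close> has mean zero. Then \<open>e\<close> has a periodic antiderivative \<open>E\<close>, and
  \<open>exp E\<close> is a positive \<open>C\<^sup>1\<close> density with \<open>exp(E(f)) f' = exp(K) exp(E)\<close> for a constant
  \<open>K\<close>. Comparing the total masses of both sides gives \<open>K = 0\<close>. The integral of \<open>exp E\<close>,
  normalized to have mass \<open>2 \<pi>\<close>, is the required \<open>C\<^sup>2\<close> diffeomorphism.
\<close>

section \<open>Calculus of lifts\<close>

definition C2_lift :: "(real \<Rightarrow> real) \<Rightarrow> (real \<Rightarrow> real) \<Rightarrow> (real \<Rightarrow> real) \<Rightarrow> (complex \<Rightarrow> complex) \<Rightarrow> bool"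
  where "C2_lift F F' F'' f \<longleftrightarrow> is_lift F f \<and> (\<forall>t. (F has_real_derivative F' t) (at t)) \<and>
     (\<forall>t. (F' has_real_derivative F'' t) (at t)) \<and> continuous_on UNIV F''"

lemma circle_C2_iff: "circle_C2 f \<longleftrightarrow> (\<exists>F F' F''. C2_lift F F' F'' f)"
  by (auto simp: circle_C2_def C2_lift_def)

lemma is_lift_cis: "is_lift F f \<Longrightarrow> f (cis t) = cis (F t)"
  by (simp add: is_lift_def)

lemma cis_Arg_circle: "z \<in> circle \<Longrightarrow> cis (Arg z) = z"
  by (cases "z = 0") (auto simp: cis_Arg sgn_div_norm)

lemma circle_cisE:
  assumes "z \<in> circle"
  obtains t where "z = cis t"
  using cis_Arg_circle[OF assms] by metis

lemma cis_add_2pi: "cis (t + 2 * pi) = cis t"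
  by (simp add: complex_eq_iff)

lemma C2_lift_derivs:
  assumes "C2_lift F F' F'' f"
  shows "circle_deriv f (cis t) = F' t" "circle_deriv2 f (cis t) = F'' t"
proof -
  have F: "deriv F = F'"
    using assms by (auto simp: C2_lift_def intro!: ext DERIV_imp_deriv)
  moreover have "deriv F' t = F'' t"
    using assms by (auto simp: C2_lift_def intro!: DERIV_imp_deriv)
  ultimately show "circle_deriv f (cis t) = F' t" "circle_deriv2 f (cis t) = F'' t"
    using assms circle_deriv_eq[of F f t] circle_deriv2_eq[of F f t] by (simp_all add: C2_lift_def)
qed

lemma C2_lift_continuous:
  assumes "C2_lift F F' F'' f"
  shows "continuous_on A F" "continuous_on A F'" "continuous_on A F''"
proof -
  have "isCont F t" "isCont F' t" for t
    using assms DERIV_isCont unfolding C2_lift_def by blast+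
  then show "continuous_on A F" "continuous_on A F'"
    by (simp_all add: continuous_at_imp_continuous_on)
  show "continuous_on A F''"
    using assms continuous_on_subset by (auto simp: C2_lift_def)
qed

lemma C2_lift_compose:
  assumes f: "C2_lift F F' F'' f" and g: "C2_lift G G' G'' g"
  shows "C2_lift (\<lambda>t. G (F t)) (\<lambda>t. G' (F t) * F' t)
           (\<lambda>t. G'' (F t) * (F' t)\<^sup>2 + G' (F t) * F'' t) (compose circle g f)"
  unfolding C2_lift_def is_lift_def
proof (intro conjI allI)
  note dF = f[unfolded C2_lift_def] and dG = g[unfolded C2_lift_def]
  show "cis (G (F t)) = compose circle g f (cis t)" for t
    using dF dG is_lift_cis[of F f t] is_lift_cis[of G g "F t"] by (simp add: compose_def)
  show d: "((\<lambda>t. G (F t)) has_real_derivative G' (F t) * F' t) (at t)" for t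
    using DERIV_chain2 dF dG by blast
  show "((\<lambda>t. G' (F t) * F' t) has_real_derivative
          G'' (F t) * (F' t)\<^sup>2 + G' (F t) * F'' t) (at t)" for t
  proof -
    have "((\<lambda>t. G' (F t)) has_real_derivative G'' (F t) * F' t) (at t)"
      using DERIV_chain2[of G' "G'' (F t)" F t] dF dG by blast
    from DERIV_mult[OF this, of F' "F'' t"] show ?thesis
      using dF by (simp add: power2_eq_square mult_ac)
  qed
  have "continuous_on UNIV (\<lambda>t. G' (F t))" "continuous_on UNIV (\<lambda>t. G'' (F t))"
    using C2_lift_continuous[OF f] C2_lift_continuous[OF g]
    by (auto intro: continuous_on_compose2)
  then show "continuous_on UNIV (\<lambda>t. G'' (F t) * (F' t)\<^sup>2 + G' (F t) * F'' t)"
    by (intro continuous_intros C2_lift_continuous[OF f])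
  show "continuous_on UNIV (\<lambda>t. G (F t))"
    using C2_lift_continuous[OF f] C2_lift_continuous[OF g]
    by (auto intro: continuous_on_compose2)
qed

lemma C2_lift_cong:
  assumes "C2_lift F F' F'' f" "\<And>z. z \<in> circle \<Longrightarrow> f z = g z"
  shows "C2_lift F F' F'' g"
  using assms by (auto simp: C2_lift_def is_lift_def)

lemma C2_lift_rotate:
  assumes "C2_lift F F' F'' f"
  shows "C2_lift (\<lambda>t. F t + k) F' F'' (\<lambda>z. cis k * f z)"
proof -
  have "((\<lambda>t. F t + k) has_real_derivative F' t) (at t)" for t
    using assms DERIV_add[of F "F' t" t UNIV "\<lambda>_. k" 0] by (simp add: C2_lift_def)
  then show ?thesis
    using assms by (auto simp: C2_lift_def is_lift_def mult.commute simp flip: cis_mult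
        intro!: continuous_intros)
qed

lemma antiderivative_real:
  fixes g :: "real \<Rightarrow> real"
  assumes "continuous_on UNIV g"
  obtains G where "\<And>t. (G has_real_derivative g t) (at t)"
proof -
  have "isCont g x" for x
    using assms by (simp add: continuous_on_eq_continuous_at)
  with einterval_antiderivative[of "- \<infinity>" "\<infinity>" g] obtain G where
    "\<And>x::real. (G has_vector_derivative g x) (at x)" by auto
  then show ?thesis
    by (intro that) (simp add: has_real_derivative_iff_has_vector_derivative)
qed

lemma zero_deriv_const:
  fixes f :: "real \<Rightarrow> real"
  assumes "\<And>t. (f has_real_derivative 0) (at t)"
  shows "f s = f t"
  using DERIV_isconst_all[of f s t] assms by blast

lemma deriv_shift_diff_const:
  fixes f g :: "real \<Rightarrow> real"
  assumes "\<And>t. (f has_real_derivative g t) (at t)" "\<And>t. g (t + p) = g t"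
  shows "f (t + p) - f t = f p - f 0"
proof -
  have "((\<lambda>t. f (t + p) - f t) has_real_derivative 0) (at t)" for t
  proof -
    have "((\<lambda>t. f (t + p)) has_real_derivative g t) (at t)"
      using assms DERIV_shift[of f "g t" t p] by metis
    from DERIV_diff[OF this assms(1)] show ?thesis by simp
  qed
  from zero_deriv_const[of "\<lambda>t. f (t + p) - f t", OF this, of t 0] show ?thesis by simp
qed

text \<open>
  A unit-modulus curve is lifted to angles without covering theory, by integrating its angular velocity.
  This also yields the derivative of the lift, which is why it is used for Moebius transformations.
\<close>

lemma lift_from_angular_velocity:
  fixes h :: "real \<Rightarrow> complex"
  assumes h: "\<And>t. norm (h t) = 1"
    and d: "\<And>t. (h has_vector_derivative \<i> * of_real (g t) * h t) (at t)"
    and g: "continuous_on UNIV g"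
  obtains G where "\<And>t. (G has_real_derivative g t) (at t)" "\<And>t. cis (G t) = h t"
proof -
  obtain G0 where G0: "\<And>t. (G0 has_real_derivative g t) (at t)"
    using antiderivative_real[OF g] by blast
  define G where "G t = G0 t - G0 0 + Arg (h 0)" for t
  have G: "(G has_real_derivative g t) (at t)" for t
    unfolding G_def by (auto intro!: derivative_eq_intros G0)
  have "((\<lambda>t. cis (- G t) * h t) has_vector_derivative 0) (at t)" for t
  proof -
    have *: "((\<lambda>t. cis (- G t)) has_vector_derivative (- g t) *\<^sub>R (\<i> * cis (- G t))) (at t)"
      using has_derivative_cis[OF has_derivative_minus[OF G[of t, unfolded has_field_derivative_def]]]
      by (simp add: has_vector_derivative_def mult.commute)
    show ?thesis
      using has_vector_derivative_mult[OF * d[of t]] by (simp add: scaleR_conv_of_real)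
  qed
  then obtain c where c: "\<And>t. cis (- G t) * h t = c"
    using has_vector_derivative_zero_constant[of UNIV "\<lambda>t. cis (- G t) * h t"] by auto
  have "c = 1"
  proof -
    have "cis (- G 0) * cis (G 0) = c"
      using c[of 0] cis_Arg_circle[of "h 0"] h[of 0] by (simp add: G_def)
    then show ?thesis by (simp add: cis_mult)
  qed
  have "cis (G t) = h t" for t
  proof -
    have "cis (G t) = cis (G t) * (cis (- G t) * h t)" by (simp add: c \<open>c = 1\<close>)
    also have "\<dots> = (cis (G t) * cis (- G t)) * h t" by (rule mult.assoc[symmetric])
    finally show ?thesis by (simp add: cis_mult)
  qed
  with G that show ?thesis by blast
qed

section \<open>Derivatives at points of the circle\<close>

lemma circle_C2_range: "circle_C2 f \<Longrightarrow> z \<in> circle \<Longrightarrow> f z \<in> circle"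
proof -
  assume f: "circle_C2 f" and z: "z \<in> circle"
  obtain F where "is_lift F f" using f by (auto simp: circle_C2_def)
  moreover obtain t where "z = cis t" using z by (rule circle_cisE)
  ultimately show "f z \<in> circle" by (simp add: is_lift_cis)
qed

lemma circle_derivs_compose:
  assumes f: "circle_C2 f" and g: "circle_C2 g" and z: "z \<in> circle"
  shows "circle_deriv (compose circle g f) z = circle_deriv g (f z) * circle_deriv f z"
    "circle_deriv2 (compose circle g f) z =
       circle_deriv2 g (f z) * (circle_deriv f z)\<^sup>2 + circle_deriv g (f z) * circle_deriv2 f z"
proof -
  obtain F F' F'' where F: "C2_lift F F' F'' f" using f circle_C2_iff by blast
  obtain G G' G'' where G: "C2_lift G G' G'' g" using g circle_C2_iff by blast
  obtain t where t: "z = cis t" using z by (rule circle_cisE)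
  have fz: "f z = cis (F t)" using F is_lift_cis[of F f t] by (simp add: C2_lift_def t)
  show "circle_deriv (compose circle g f) z = circle_deriv g (f z) * circle_deriv f z"
    "circle_deriv2 (compose circle g f) z =
       circle_deriv2 g (f z) * (circle_deriv f z)\<^sup>2 + circle_deriv g (f z) * circle_deriv2 f z"
    unfolding fz unfolding t C2_lift_derivs[OF F] C2_lift_derivs[OF G]
      C2_lift_derivs[OF C2_lift_compose[OF F G]] by (rule refl)+
qed

lemma circle_derivs_rotate:
  assumes g: "circle_C2 g" and z: "z \<in> circle"
    and f: "\<And>w. w \<in> circle \<Longrightarrow> f w = cis k * g w"
  shows "circle_deriv f z = circle_deriv g z" "circle_deriv2 f z = circle_deriv2 g z"
proof -
  obtain G G' G'' where G: "C2_lift G G' G'' g" using g circle_C2_iff by blast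
  have F: "C2_lift (\<lambda>t. G t + k) G' G'' f"
    by (rule C2_lift_cong[OF C2_lift_rotate[OF G, of k]]) (simp add: f)
  obtain t where t: "z = cis t" using z by (rule circle_cisE)
  show "circle_deriv f z = circle_deriv g z" "circle_deriv2 f z = circle_deriv2 g z"
    unfolding t C2_lift_derivs[OF F] C2_lift_derivs[OF G] by (rule refl)+
qed

text \<open>
  Since \<open>cis\<close> is a quotient map, continuity of a function on the circle can be checked in the
  angle coordinate.
\<close>

lemma quotient_map_cis: "quotient_map (top_of_set {0..2 * pi}) (top_of_set circle) cis"
proof (rule continuous_imp_quotient_map)
  have "cis ` {0..2 * pi} = circle"
  proof (intro equalityI subsetI)
    fix z assume "z \<in> circle"
    then have "z = cis (Arg2pi z)" "Arg2pi z \<in> {0..2 * pi}"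
      using Arg2pi[of z] by (auto simp: cis_conv_exp is_Arg_def less_imp_le)
    then show "z \<in> cis ` {0..2 * pi}" by blast
  qed auto
  then show "cis ` topspace (top_of_set {0..2 * pi}) = topspace (top_of_set circle)" by simp
qed (auto intro!: continuous_intros simp: compact_space_subtopology Hausdorff_space_subtopology)

lemma continuous_on_circle_cis:
  assumes "continuous_on UNIV (\<lambda>t. g (cis t) :: real)"
  shows "continuous_on circle g"
proof -
  have "continuous_map (top_of_set {0..2 * pi}) euclidean (g \<circ> cis)"
    using continuous_on_subset[OF assms] by (simp add: o_def)
  from continuous_compose_quotient_map[OF quotient_map_cis this] show ?thesis by simp
qed

lemma continuous_circle_derivs:
  assumes "circle_C2 f"
  shows "continuous_on circle (circle_deriv f)" "continuous_on circle (circle_deriv2 f)"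
proof -
  obtain F F' F'' where F: "C2_lift F F' F'' f" using assms circle_C2_iff by blast
  show "continuous_on circle (circle_deriv f)" "continuous_on circle (circle_deriv2 f)"
    using C2_lift_continuous[OF F, of UNIV]
    by (auto intro!: continuous_on_circle_cis simp: C2_lift_derivs[OF F])
qed

section \<open>Circle diffeomorphisms and their lifts\<close>

lemma shift_multiple_2pi:
  fixes F :: "real \<Rightarrow> real"
  assumes "\<And>t. F (t + 2 * pi) = F t + 2 * pi"
  shows "F (t + 2 * pi * of_int n) = F t + 2 * pi * of_int n"
proof -
  have *: "F (t + 2 * pi * real k) = F t + 2 * pi * real k" for t k
  proof (induction k)
    case (Suc k)
    have "F (t + 2 * pi * real (Suc k)) = F ((t + 2 * pi * real k) + 2 * pi)"
      by (simp add: algebra_simps)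
    then show ?case unfolding assms Suc by (simp add: algebra_simps)
  qed simp
  show ?thesis
  proof (cases n)
    case (nonneg k)
    then show ?thesis using *[of t k] by simp
  next
    case (neg k)
    then have n: "of_int n = - real (Suc k)" by simp
    show ?thesis
      using *[of "t + 2 * pi * of_int n" "Suc k"] unfolding n by (simp only: mult_minus_right) simp
  qed
qed

definition circle_map_of :: "(real \<Rightarrow> real) \<Rightarrow> complex \<Rightarrow> complex" where
  "circle_map_of F = restrict (\<lambda>z. cis (F (Arg z))) circle"

lemma circle_map_of_cis:
  assumes "\<And>t. F (t + 2 * pi) = F t + 2 * pi"
  shows "circle_map_of F (cis t) = cis (F t)"
proof -
  have "cis (Arg (cis t)) = cis t" by (rule cis_Arg_circle) simp
  then obtain n :: int where "Arg (cis t) = t + 2 * pi * n" using cis_eqD by blast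
  then show ?thesis
    using shift_multiple_2pi[of F t n, OF assms]
    by (simp add: circle_map_of_def cis_mult[symmetric] cis_multiple_2pi)
qed

text \<open>
  The inverse of the lift is a lift of the inverse, and it is \<open>C\<^sup>2\<close> because \<open>F'\<close> has no zero.
\<close>

lemma diffeo_from_lift:
  assumes d: "\<And>t. (F has_real_derivative F' t) (at t)"
    and d2: "\<And>t. (F' has_real_derivative F'' t) (at t)"
    and c: "continuous_on UNIV F''"
    and pos: "\<And>t. F' t > 0"
    and per: "\<And>t. F (t + 2 * pi) = F t + 2 * pi"
  shows "circle_map_of F \<in> circle_diffeos"
proof -
  have mono: "strict_mono F"
    unfolding strict_mono_def using d pos DERIV_pos_imp_increasing by blast
  then have inj: "inj F" by (rule strict_mono_imp_inj_on)
  have cont: "continuous_on A F" for A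
    using d DERIV_isCont by (blast intro: continuous_at_imp_continuous_on)
  have "surj F"
  proof -
    have "\<exists>x. F x = y" for y
    proof -
      obtain n :: nat where n: "\<bar>y - F 0\<bar> < of_nat n" using reals_Archimedean2 by blast
      have "1 * real n \<le> 2 * pi * real n" using pi_gt3 by (intro mult_right_mono) auto
      then have n': "\<bar>y - F 0\<bar> < 2 * pi * real n" using n by linarith
      have "F (2 * pi * of_int (- int n)) \<le> y" "y \<le> F (2 * pi * of_int (int n))"
        using n' shift_multiple_2pi[of F 0 "- int n", OF per] shift_multiple_2pi[of F 0 "int n", OF per]
        by (simp_all add: abs_less_iff)
      then show ?thesis
        using IVT'[of F "2 * pi * of_int (- int n)" y "2 * pi * of_int (int n)"] cont by auto
    qed
    then show ?thesis by (metis surjI)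
  qed
  define G where "G = inv_into UNIV F"
  have FG: "F (G s) = s" for s using \<open>surj F\<close> by (simp add: G_def surj_f_inv_f)
  have GF: "G (F t) = t" for t using inj by (simp add: G_def)
  have monoG: "strict_mono G"
    unfolding strict_mono_def using FG mono by (metis strict_mono_less)
  have "range G = UNIV" using GF by (metis surjI)
  then have contG: "continuous_on UNIV G"
    using monoG by (intro continuous_onI_mono) (auto simp: strict_mono_less_eq)
  have F'0: "F' t \<noteq> 0" for t using pos[of t] by simp
  have dG: "(G has_real_derivative 1 / F' (G s)) (at s)" for s
    using DERIV_inverse_function[of F "F' (G s)" G s "s - 1" "s + 1"] d F'0 FG contG
    by (simp add: continuous_on_eq_continuous_at divide_inverse)
  have dG2: "((\<lambda>s. 1 / F' (G s)) has_real_derivative - F'' (G s) / (F' (G s)) ^ 3) (at s)" for s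
  proof -
    have "((\<lambda>s. F' (G s)) has_real_derivative F'' (G s) * (1 / F' (G s))) (at s)"
      using DERIV_chain2[OF d2 dG] .
    then have "((\<lambda>s. 1 / F' (G s)) has_real_derivative
        (0 * F' (G s) - 1 * (F'' (G s) * (1 / F' (G s)))) / (F' (G s) * F' (G s))) (at s)"
      by (intro DERIV_divide DERIV_const F'0)
    then show ?thesis using F'0 by (simp add: power3_eq_cube mult.assoc)
  qed
  have cF': "continuous_on UNIV F'"
    using d2 DERIV_isCont by (blast intro: continuous_at_imp_continuous_on)
  have cG2: "continuous_on UNIV (\<lambda>s. - F'' (G s) / (F' (G s)) ^ 3)"
    using F'0 by (intro continuous_intros continuous_on_compose2[OF c contG]
        continuous_on_compose2[OF cF' contG]) auto
  have perG: "G (s + 2 * pi) = G s + 2 * pi" for s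
    using per[of "G s"] GF[of "G s + 2 * pi"] by (simp add: FG)
  let ?f = "circle_map_of F" and ?g = "circle_map_of G"
  note f = circle_map_of_cis[of F, OF per] and g = circle_map_of_cis[of G, OF perG]
  have fg: "?f z \<in> circle" "?g z \<in> circle" "?g (?f z) = z" "?f (?g z) = z" if "z \<in> circle" for z
  proof -
    obtain t where "z = cis t" using circle_cisE[OF \<open>z \<in> circle\<close>] .
    then show "?f z \<in> circle" "?g z \<in> circle" "?g (?f z) = z" "?f (?g z) = z"
      by (simp_all add: f g FG GF)
  qed
  then have bij: "bij_betw ?f circle circle"
    by (intro bij_betwI[where g = ?g]) auto
  then have Bij: "?f \<in> Bij circle"
    by (simp add: Bij_def circle_map_of_def)
  have "inv\<^bsub>BijGroup circle\<^esub> ?f = ?g"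
  proof -
    have "inv_into circle ?f z = ?g z" if "z \<in> circle" for z
      using inv_into_f_eq[OF bij_betw_imp_inj_on[OF bij] fg(2)[OF that] fg(4)[OF that]] .
    then have "restrict (inv_into circle ?f) circle = restrict ?g circle"
      by (intro restrict_ext) simp
    then show ?thesis
      unfolding inv_BijGroup[OF Bij] by (simp add: circle_map_of_def)
  qed
  moreover have F: "C2_lift F F' F'' ?f" and
    "C2_lift G (\<lambda>s. 1 / F' (G s)) (\<lambda>s. - F'' (G s) / (F' (G s)) ^ 3) ?g"
    using f g cont contG d d2 c dG dG2 cG2 by (simp_all add: C2_lift_def is_lift_def)
  then have "circle_C2 ?f" "circle_C2 ?g"
    unfolding circle_C2_iff by blast+
  moreover have "orientation_preserving ?f"
    using F mono by (auto simp: orientation_preserving_def C2_lift_def)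
  ultimately show ?thesis
    using Bij by (simp add: circle_diffeos_def)
qed

text \<open>
  The derivative does not vanish because the inverse of \<open>f\<close> is differentiable as well; it is
  nonnegative because every lift of \<open>f\<close> is increasing, all lifts being equal up to a constant.
\<close>

lemma diffeo_deriv_pos:
  assumes "f \<in> circle_diffeos" and F: "C2_lift F F' F'' f"
  shows "strict_mono F" "F' t > 0"
proof -
  let ?g = "inv\<^bsub>BijGroup circle\<^esub> f"
  have f: "f \<in> Bij circle" "circle_C2 ?g" "orientation_preserving f"
    using assms by (auto simp: circle_diffeos_def)
  obtain F0 where F0: "is_lift F0 f" "strict_mono F0" using f by (auto simp: orientation_preserving_def)
  obtain c where c: "\<And>t. F t = F0 t + c"
    using is_lift_diff_const F F0(1) unfolding C2_lift_def by blast
  show mono: "strict_mono F" using F0(2) by (simp add: c strict_mono_def)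
  obtain G G' G'' where G: "C2_lift G G' G'' ?g" using f circle_C2_iff by blast
  have dF: "(F has_real_derivative F' t) (at t)" for t using F by (simp add: C2_lift_def)
  have "compose circle ?g f z = z" if "z \<in> circle" for z
    using f(1) that by (simp add: inv_BijGroup Bij_compose_restrict_eq)
  then have "is_lift (\<lambda>t. t) (compose circle ?g f)" by (simp add: is_lift_def)
  then have "circle_deriv (compose circle ?g f) (cis t) = 1"
    by (simp add: circle_deriv_eq[of "\<lambda>t. t"])
  then have "F' t \<noteq> 0"
    using C2_lift_derivs(1)[OF C2_lift_compose[OF F G], of t] by auto
  moreover have "F' t \<ge> 0"
  proof (rule ccontr)
    assume "\<not> F' t \<ge> 0"
    then obtain e where e: "e > 0" "\<And>h. h > 0 \<Longrightarrow> h < e \<Longrightarrow> F t > F (t + h)"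
      using DERIV_neg_dec_right[OF dF, of t] by auto
    then have "F t > F (t + e / 2)" by simp
    moreover have "F t < F (t + e / 2)" using mono e(1) by (simp add: strict_mono_def)
    ultimately show False by simp
  qed
  ultimately show "F' t > 0" by simp
qed

text \<open>
  The increment of \<open>F\<close> over a period is a positive multiple of \<open>2 \<pi>\<close>. If it were \<open>4 \<pi>\<close> or more,
  then \<open>F\<close> would gain \<open>2 \<pi>\<close> before the period is over, against injectivity of \<open>f\<close>.
\<close>

lemma diffeo_degree_one:
  assumes "f \<in> circle_diffeos" and F: "is_lift F f" and mono: "strict_mono F"
  shows "F (t + 2 * pi) = F t + 2 * pi"
proof -
  have c: "continuous_on A F" for A using F continuous_on_subset by (auto simp: is_lift_def)
  have "is_lift (\<lambda>t. F (t + 2 * pi)) f"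
    using F cis_add_2pi unfolding is_lift_def
    by (auto intro!: continuous_on_compose2[OF c] continuous_intros)
  then obtain e where e: "\<And>t. F (t + 2 * pi) = F t + e"
    using is_lift_diff_const[OF _ F] by blast
  have "cis (F 0 + e) = cis (F 0)"
    using is_lift_cis[OF F, of 0] is_lift_cis[OF F, of "0 + 2 * pi"] e[of 0] cis_add_2pi[of 0] by simp
  then obtain n :: int where n: "e = 2 * pi * n" using cis_eqD by force
  have "F 0 < F (0 + 2 * pi)" using mono by (simp add: strict_mono_def)
  then have "e > 0" using e[of 0] by simp
  then have "n \<ge> 1" by (simp add: n zero_less_mult_iff)
  moreover have "\<not> n \<ge> 2"
  proof
    assume "n \<ge> 2"
    then have "2 * pi * 2 \<le> e" unfolding n by simp
    then have e2: "2 * pi < e" using pi_gt_zero by linarith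
    have "F 0 \<le> F 0 + 2 * pi" "F 0 + 2 * pi \<le> F (2 * pi)" using e[of 0] e2 by simp_all
    then obtain s where s: "0 \<le> s" "s \<le> 2 * pi" "F s = F 0 + 2 * pi"
      using IVT'[of F 0 "F 0 + 2 * pi" "2 * pi"] c by auto
    have "s \<noteq> 0" "s \<noteq> 2 * pi" using s(3) e[of 0] e2 by auto
    have "f (cis s) = f (cis 0)"
      unfolding is_lift_cis[OF F] s(3) by (rule cis_add_2pi)
    moreover have "inj_on f circle" using assms(1) by (auto simp: circle_diffeos_def Bij_def bij_betw_def)
    ultimately have "cis s = cis 0" by (auto dest: inj_onD)
    then obtain m :: int where m: "s = 0 + 2 * pi * m" using cis_eqD by blast
    have "0 < s" "s < 2 * pi" using s \<open>s \<noteq> 0\<close> \<open>s \<noteq> 2 * pi\<close> by simp_all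
    then have "0 < 2 * pi * m" "2 * pi * m < 2 * pi * 1" using m by simp_all
    then have "0 < m" "m < 1"
      by (simp_all add: zero_less_mult_iff)
    then show False by simp
  qed
  ultimately have "n = 1" by simp
  then show ?thesis using e n by simp
qed

lemma diffeo_circle_deriv_pos:
  assumes "f \<in> circle_diffeos" "z \<in> circle"
  shows "circle_deriv f z > 0"
proof -
  obtain F F' F'' where F: "C2_lift F F' F'' f"
    using assms circle_C2_iff by (auto simp: circle_diffeos_def)
  obtain t where "z = cis t" using assms(2) by (rule circle_cisE)
  then show ?thesis using C2_lift_derivs(1)[OF F] diffeo_deriv_pos(2)[OF assms(1) F] by simp
qed

section \<open>Moebius transformations modulo rotations\<close>

text \<open>
  For \<open>|a|\<^sup>2 - |b|\<^sup>2 = 1\<close> this is the action of the group \<open>SU(1,1)\<close>. It is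
  \<open>SL2R_action\<close> written in the coordinates \<open>SL2R_alpha\<close>, \<open>SL2R_beta\<close>, in which composition
  and derivatives are easy to compute.
\<close>

definition su11_action :: "complex \<Rightarrow> complex \<Rightarrow> complex \<Rightarrow> complex" where
  "su11_action a b = restrict (\<lambda>z. (a * z + b) / (cnj b * z + cnj a)) circle"

abbreviation su11 :: "complex \<Rightarrow> complex \<Rightarrow> bool" where
  "su11 a b \<equiv> a * cnj a - b * cnj b = 1"

lemma su11_norm: "su11 a b \<longleftrightarrow> (norm a)\<^sup>2 - (norm b)\<^sup>2 = 1"
proof -
  have "a * cnj a - b * cnj b = of_real ((norm a)\<^sup>2 - (norm b)\<^sup>2)"
    by (simp only: of_real_diff complex_norm_square)
  then show ?thesis by (simp only: of_real_eq_1_iff)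
qed

lemma su11_SL2R: "A \<in> SL2R \<longleftrightarrow> su11 (SL2R_alpha A) (SL2R_beta A)"
  by (simp add: SL2R_def det_alpha_beta su11_norm)

lemma SL2R_action_su11: "SL2R_action A = su11_action (SL2R_alpha A) (SL2R_beta A)"
  by (simp add: SL2R_action_def su11_action_def)

lemma moebius_circleE:
  assumes "P \<in> moebius_circle"
  obtains a b where "su11 a b" "P = su11_action a b"
  using assms unfolding SL2R_action_image[symmetric]
  by (auto simp: su11_SL2R SL2R_action_su11)

lemma su11_obtain_matrix:
  assumes "su11 a b"
  obtains A where "A \<in> SL2R" "SL2R_alpha A = a" "SL2R_beta A = b" "SL2R_action A = su11_action a b"
  using alpha_beta_surj[of a b] assms by (auto simp: su11_SL2R SL2R_action_su11)

lemma su11_action_in_moebius: "su11 a b \<Longrightarrow> su11_action a b \<in> moebius_circle"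
  using su11_obtain_matrix SL2R_action_image by (metis image_eqI)

lemma circle_cnj: "z \<in> circle \<Longrightarrow> z * cnj z = 1"
  by (simp add: complex_norm_square[symmetric])

lemma su11_denominator_cnj:
  assumes "z \<in> circle"
  shows "a * z + b = z * cnj (cnj b * z + cnj a)"
  using circle_cnj[OF assms] by (simp add: algebra_simps)

lemma su11_denominator_nz:
  assumes "su11 a b" "z \<in> circle"
  shows "cnj b * z + cnj a \<noteq> 0"
  using su11_obtain_matrix[OF assms(1)] SL2R_denominator_nz[OF _ assms(2)] by metis

lemma su11_action_circle:
  assumes "su11 a b" "z \<in> circle"
  shows "su11_action a b z \<in> circle"
proof -
  have "norm (a * z + b) = norm (cnj b * z + cnj a)"
    unfolding su11_denominator_cnj[OF assms(2), of a b] using assms(2)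
    by (simp only: norm_mult complex_mod_cnj) simp
  then show ?thesis
    using assms su11_denominator_nz[OF assms] by (simp add: su11_action_def norm_divide)
qed

lemma su11_mult:
  assumes "su11 a b" "su11 c d"
  shows "su11 (a * c + b * cnj d) (a * d + b * cnj c)"
proof -
  have "(a * c + b * cnj d) * cnj (a * c + b * cnj d) - (a * d + b * cnj c) * cnj (a * d + b * cnj c)
      = (a * cnj a - b * cnj b) * (c * cnj c - d * cnj d)"
    by (simp add: algebra_simps)
  then show ?thesis using assms by simp
qed

lemma su11_action_mult:
  assumes "su11 a b" "su11 c d"
  shows "compose circle (su11_action a b) (su11_action c d) =
    su11_action (a * c + b * cnj d) (a * d + b * cnj c)"
proof
  fix z
  show "compose circle (su11_action a b) (su11_action c d) z =
    su11_action (a * c + b * cnj d) (a * d + b * cnj c) z"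
  proof (cases "z \<in> circle")
    case True
    define u v where "u = c * z + d" "v = cnj d * z + cnj c"
    have v: "v \<noteq> 0"
      using su11_denominator_nz[OF assms(2) True] by (simp add: u_v_def)
    have w: "su11_action c d z = u / v" "u / v \<in> circle"
      using True su11_action_circle[OF assms(2) True] by (simp_all add: su11_action_def u_v_def)
    have "compose circle (su11_action a b) (su11_action c d) z =
        (a * (u / v) + b) / (cnj b * (u / v) + cnj a)"
      using True w by (simp add: compose_eq su11_action_def)
    also have "\<dots> = ((a * u + b * v) / v) / ((cnj b * u + cnj a * v) / v)"
      using v by (simp add: field_simps)
    also have "\<dots> = (a * u + b * v) / (cnj b * u + cnj a * v)"
      using v by simp
    finally show ?thesis
      using True by (simp add: su11_action_def u_v_def algebra_simps)
  qed (simp add: compose_def su11_action_def)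
qed

lemma su11_action_one: "su11_action 1 0 = (\<lambda>z\<in>circle. z)"
  by (auto simp: su11_action_def)

lemma su11_action_Bij:
  assumes "su11 a b"
  shows "su11_action a b \<in> Bij circle"
proof -
  have inv: "su11 (cnj a) (- b)" using assms by (simp add: mult.commute)
  have "compose circle (su11_action a b) (su11_action (cnj a) (- b)) = (\<lambda>z\<in>circle. z)"
    "compose circle (su11_action (cnj a) (- b)) (su11_action a b) = (\<lambda>z\<in>circle. z)"
    using assms su11_action_mult[OF assms inv] su11_action_mult[OF inv assms]
    by (simp_all add: su11_action_one mult.commute)
  then have "su11_action a b (su11_action (cnj a) (- b) z) = z"
    "su11_action (cnj a) (- b) (su11_action a b z) = z" if "z \<in> circle" for z
    using that by (metis compose_eq restrict_apply')+
  then have "bij_betw (su11_action a b) circle circle"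
    using su11_action_circle[OF assms] su11_action_circle[OF inv]
    by (intro bij_betwI[where g = "su11_action (cnj a) (- b)"]) auto
  then show ?thesis by (simp add: Bij_def su11_action_def)
qed

lemma moebius_Bij: "P \<in> moebius_circle \<Longrightarrow> P \<in> Bij circle"
  by (auto elim!: moebius_circleE simp: su11_action_Bij)

lemma moebius_compose:
  assumes "P \<in> moebius_circle" "Q \<in> moebius_circle"
  shows "compose circle P Q \<in> moebius_circle"
  using assms by (auto elim!: moebius_circleE simp: su11_action_mult su11_mult su11_action_in_moebius
      simp del: complex_cnj_add complex_cnj_mult)

lemma su11_rotate:
  assumes "su11 a b"
  shows "su11 (cis k * a) (cis k * b)"
    "z \<in> circle \<Longrightarrow> su11_action (cis k * a) (cis k * b) z = cis (2 * k) * su11_action a b z"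
proof -
  have "cis k * a * cnj (cis k * a) - cis k * b * cnj (cis k * b) =
      (cis k * cnj (cis k)) * (a * cnj a - b * cnj b)"
    unfolding complex_cnj_mult by algebra
  then show "su11 (cis k * a) (cis k * b)"
    using assms circle_cnj[of "cis k"] by simp
  assume z: "z \<in> circle"
  have "(cis k * a * z + cis k * b) / (cnj (cis k * b) * z + cnj (cis k * a)) =
    (cis k * (a * z + b)) / (cis (- k) * (cnj b * z + cnj a))"
    by (simp add: cis_cnj algebra_simps)
  also have "\<dots> = (cis k / cis (- k)) * ((a * z + b) / (cnj b * z + cnj a))"
    by simp
  finally show "su11_action (cis k * a) (cis k * b) z = cis (2 * k) * su11_action a b z"
    using z by (simp add: su11_action_def cis_divide)
qed

text \<open>
  The product \<open>p = a b*\<close>, where \<open>b*\<close> is the conjugate of \<open>b\<close>, does not change when \<open>(a, b)\<close> is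
  multiplied by a unit scalar. Such a scalar amounts to a rotation on the left, and a change of sign
  of the matrix is a special case. So \<open>p\<close> is a coordinate on the space of cosets of the rotations in
  the Moebius group, which it identifies with \<open>\<complex>\<close> (\<open>same_coord_rotation\<close>, \<open>coset_section\<close>).
\<close>

definition coset_coord :: "(complex \<Rightarrow> complex) \<Rightarrow> complex" where
  "coset_coord P = (THE p. \<exists>a b. su11 a b \<and> P = su11_action a b \<and> p = a * cnj b)"

lemma coset_coord_su11:
  assumes "su11 a b"
  shows "coset_coord (su11_action a b) = a * cnj b"
proof -
  obtain A where A: "A \<in> SL2R" "SL2R_alpha A = a" "SL2R_beta A = b" "SL2R_action A = su11_action a b"
    using su11_obtain_matrix[OF assms] .
  have "c * cnj d = a * cnj b" if cd: "su11 c d" "su11_action a b = su11_action c d" for c d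
  proof -
    obtain C where C: "C \<in> SL2R" "SL2R_alpha C = c" "SL2R_beta C = d" "SL2R_action C = su11_action c d"
      using su11_obtain_matrix[OF cd(1)] .
    with A cd(2) have "C = A \<or> C = - A"
      using SL2R_action_eq_iff[of A C] by simp
    then show ?thesis using A C by (auto simp: alpha_uminus beta_uminus)
  qed
  then show ?thesis
    unfolding coset_coord_def using assms by (intro the_equality) blast+
qed

lemma continuous_map_coset_coord: "continuous_map moebius_topology euclidean coset_coord"
proof (rule continuous_compose_quotient_map[OF quotient_map_SL2R_action])
  have "continuous_on SL2R (\<lambda>A. SL2R_alpha A * cnj (SL2R_beta A))"
    unfolding SL2R_alpha_def SL2R_beta_def Complex_eq by (intro continuous_intros) auto
  then show "continuous_map (top_of_set SL2R) euclidean (coset_coord \<circ> SL2R_action)"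
    by (auto simp: su11_SL2R SL2R_action_su11 coset_coord_su11 elim: continuous_on_eq)
qed

text \<open>
  The derivative at \<open>z\<close> of a transformation with coset coordinate \<open>p\<close>, as a function of
  \<open>w = p z\<close>. The derivative is \<open>1 / |b* z + a*|\<^sup>2\<close>, and
  \<open>|b* z + a*|\<^sup>2 = |a|\<^sup>2 + |b|\<^sup>2 + 2 Re w\<close>; the square root is
  \<open>|a|\<^sup>2 + |b|\<^sup>2\<close> expressed through \<open>|p| = |a| |b|\<close> (\<open>su11_sqrt\<close>).
\<close>

definition coset_deriv :: "complex \<Rightarrow> real" where
  "coset_deriv w = 1 / (sqrt (1 + 4 * (norm w)\<^sup>2) + 2 * Re w)"

lemma coset_denominator_pos: "sqrt (1 + 4 * (norm w)\<^sup>2) + 2 * Re w > 0"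
proof -
  have "\<bar>2 * Re w\<bar> \<le> 2 * norm w" using abs_Re_le_cmod[of w] by simp
  also have "\<dots> = sqrt (4 * (norm w)\<^sup>2)"
    by (simp add: real_sqrt_mult)
  also have "\<dots> < sqrt (1 + 4 * (norm w)\<^sup>2)" by simp
  finally show ?thesis by linarith
qed

lemma coset_deriv_pos: "coset_deriv w > 0"
  using coset_denominator_pos by (simp add: coset_deriv_def)

lemma su11_sqrt:
  assumes "su11 a b"
  shows "sqrt (1 + 4 * (norm (a * cnj b))\<^sup>2) = (norm a)\<^sup>2 + (norm b)\<^sup>2"
proof -
  have "(norm a)\<^sup>2 = 1 + (norm b)\<^sup>2" using assms su11_norm by simp
  then have "1 + 4 * ((norm a)\<^sup>2 * (norm b)\<^sup>2) = ((norm a)\<^sup>2 + (norm b)\<^sup>2)\<^sup>2"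
    by algebra
  then have "1 + 4 * (norm (a * cnj b))\<^sup>2 = ((norm a)\<^sup>2 + (norm b)\<^sup>2)\<^sup>2"
    by (simp only: norm_mult power_mult_distrib complex_mod_cnj)
  then show ?thesis by simp
qed

lemma su11_denominator_norm:
  assumes "su11 a b" "z \<in> circle"
  shows "(norm (cnj b * z + cnj a))\<^sup>2 = 1 / coset_deriv (a * cnj b * z)"
proof -
  have "complex_of_real ((norm (cnj b * z + cnj a))\<^sup>2) = (cnj b * z + cnj a) * cnj (cnj b * z + cnj a)"
    by (rule complex_norm_square)
  also have "\<dots> = b * cnj b * (z * cnj z) + a * cnj a + (a * cnj b * z + cnj (a * cnj b * z))"
    by (simp add: algebra_simps)
  also have "\<dots> = complex_of_real ((norm b)\<^sup>2 + (norm a)\<^sup>2 + 2 * Re (a * cnj b * z))"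
    using circle_cnj[OF assms(2)] by (simp only: complex_add_cnj flip: complex_norm_square) simp
  finally have "(norm (cnj b * z + cnj a))\<^sup>2 = (norm b)\<^sup>2 + (norm a)\<^sup>2 + 2 * Re (a * cnj b * z)"
    using of_real_eq_iff by blast
  moreover have "norm (a * cnj b * z) = norm (a * cnj b)"
    using assms(2) by (simp add: norm_mult)
  ultimately show ?thesis
    by (simp add: coset_deriv_def su11_sqrt[OF assms(1)])
qed

lemma coset_deriv_deriv:
  "((\<lambda>t. coset_deriv (p * cis t)) has_real_derivative
     2 * Im (p * cis t) * (coset_deriv (p * cis t))\<^sup>2) (at t)"
proof -
  have n: "coset_deriv (p * cis t) = 1 / (sqrt (1 + 4 * (norm p)\<^sup>2) + 2 * (Re p * cos t - Im p * sin t))" for t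
    by (simp add: coset_deriv_def norm_mult)
  have "sqrt (1 + 4 * (norm p)\<^sup>2) + 2 * (Re p * cos t - Im p * sin t) \<noteq> 0" 
    using coset_denominator_pos[of "p * cis t"] by (simp add: norm_mult)
  then show ?thesis
    unfolding n by (auto intro!: derivative_eq_intros simp: field_simps power2_eq_square)
qed

text \<open>
  For \<open>z = cis t\<close> and \<open>v = b* z + a*\<close> one has \<open>a z + b = z v*\<close>, so the image of \<open>z\<close> is
  \<open>z v* / v\<close>, while its derivative in \<open>t\<close> is \<open>\<i> z / v\<^sup>2\<close>. Hence the angular velocity is
  \<open>1 / |v|\<^sup>2\<close>.
\<close>

lemma su11_C2_lift:
  assumes "su11 a b"
  obtains G where "C2_lift G (\<lambda>t. coset_deriv (a * cnj b * cis t))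
      (\<lambda>t. 2 * Im (a * cnj b * cis t) * (coset_deriv (a * cnj b * cis t))\<^sup>2) (su11_action a b)"
proof -
  define p where "p = a * cnj b"
  have cont: "continuous_on UNIV (\<lambda>t. coset_deriv (p * cis t))"
    using coset_deriv_deriv DERIV_isCont by (blast intro: continuous_at_imp_continuous_on)
  define h where "h t = su11_action a b (cis t)" for t
  have h: "h = (\<lambda>t. (a * cis t + b) / (cnj b * cis t + cnj a))"
    by (auto simp: h_def su11_action_def)
  have "(h has_vector_derivative \<i> * of_real (coset_deriv (p * cis t)) * h t) (at t)" for t
  proof -
    define z v where "z = cis t" "v = cnj b * z + cnj a"
    have z: "z \<in> circle" by (simp add: z_v_def)
    have v: "v \<noteq> 0" using su11_denominator_nz[OF assms z] by (simp add: z_v_def)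
    have "((\<lambda>w. (a * w + b) / (cnj b * w + cnj a)) has_field_derivative 
        (a * v - (a * z + b) * cnj b) / (v * v)) (at z)"
      using v by (auto intro!: derivative_eq_intros simp: z_v_def)
    moreover have "(cis has_vector_derivative \<i> * z) (at t)"
      unfolding z_v_def has_vector_derivative_def
      using has_derivative_cis[of "\<lambda>t. t"] by (auto simp: scaleR_conv_of_real algebra_simps)
    ultimately have "(h has_vector_derivative \<i> * z * ((a * v - (a * z + b) * cnj b) / (v * v))) (at t)"
      using field_vector_diff_chain_at[of cis "\<i> * z" t] unfolding h z_v_def o_def by blast
    moreover have "a * v - (a * z + b) * cnj b = 1"
      using assms by (simp add: z_v_def algebra_simps)
    moreover have "of_real (coset_deriv (p * z)) = 1 / (v * cnj v)"
    proof -
      have "coset_deriv (p * z) = 1 / (norm v)\<^sup>2"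
        using su11_denominator_norm[OF assms z] by (simp add: p_def z_v_def)
      then show ?thesis by (simp add: complex_norm_square del: of_real_power)
    qed
    moreover have "h t = z * cnj v / v"
      using su11_denominator_cnj[OF z, of a b] by (simp add: h z_v_def)
    ultimately show ?thesis
      using v by (simp add: z_v_def(1))
  qed
  moreover have "norm (h t) = 1" for t
    using su11_action_circle[OF assms, of "cis t"] by (simp add: h_def)
  ultimately obtain G where G: "\<And>t. (G has_real_derivative coset_deriv (p * cis t)) (at t)" "\<And>t. cis (G t) = h t"
    using lift_from_angular_velocity[OF _ _ cont, of h] by blast
  have "continuous_on UNIV G"
    using G(1) DERIV_isCont by (blast intro: continuous_at_imp_continuous_on)
  moreover have "continuous_on UNIV (\<lambda>t. 2 * Im (p * cis t) * (coset_deriv (p * cis t))\<^sup>2)"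
    by (intro continuous_intros cont)
  ultimately have "C2_lift G (\<lambda>t. coset_deriv (p * cis t))
      (\<lambda>t. 2 * Im (p * cis t) * (coset_deriv (p * cis t))\<^sup>2) (su11_action a b)"
    using G coset_deriv_deriv unfolding C2_lift_def is_lift_def h_def by blast
  then show ?thesis using that by (simp add: p_def)
qed

lemma moebius_C2_lift:
  assumes "P \<in> moebius_circle"
  obtains G where "C2_lift G (\<lambda>t. coset_deriv (coset_coord P * cis t))
      (\<lambda>t. 2 * Im (coset_coord P * cis t) * (coset_deriv (coset_coord P * cis t))\<^sup>2) P"
proof -
  obtain a b where ab: "su11 a b" "P = su11_action a b" using assms by (rule moebius_circleE)
  from su11_C2_lift[OF ab(1)] that show ?thesis
    unfolding ab(2) coset_coord_su11[OF ab(1)] by blast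
qed

lemma moebius_derivs:
  assumes "P \<in> moebius_circle" "z \<in> circle"
  shows "circle_deriv P z = coset_deriv (coset_coord P * z)"
    "circle_deriv2 P z = 2 * Im (coset_coord P * z) * (circle_deriv P z)\<^sup>2"
proof -
  obtain t where z: "z = cis t" using circle_cisE[OF assms(2)] .
  obtain G where "C2_lift G (\<lambda>t. coset_deriv (coset_coord P * cis t))
      (\<lambda>t. 2 * Im (coset_coord P * cis t) * (coset_deriv (coset_coord P * cis t))\<^sup>2) P"
    using moebius_C2_lift[OF assms(1)] .
  note d = C2_lift_derivs[OF this, of t]
  show "circle_deriv P z = coset_deriv (coset_coord P * z)"
    "circle_deriv2 P z = 2 * Im (coset_coord P * z) * (circle_deriv P z)\<^sup>2"
    unfolding z d by (rule refl)+
qed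

text \<open>
  Solves for \<open>w\<close> the equations saying that the first and second derivatives are \<open>d\<close> and \<open>d2\<close>. The
  second one gives \<open>Im w\<close>. Once the square root in the first one is isolated and squared, the terms in
  \<open>(Re w)\<^sup>2\<close> cancel and a linear equation for \<open>Re w\<close> remains.
\<close>

definition jet_coord :: "real \<Rightarrow> real \<Rightarrow> complex" where
  "jet_coord d d2 = Complex ((1 / d - d - (d2 / d)\<^sup>2 / d) / 4) (d2 / d\<^sup>2 / 2)"

lemma jet_coord_iff:
  assumes "d > 0"
  shows "coset_deriv w = d \<and> 2 * Im w * d\<^sup>2 = d2 \<longleftrightarrow> w = jet_coord d d2"
proof -
  define x y where "x = Re w" "y = Im w"
  have w: "coset_deriv w = d \<longleftrightarrow> sqrt (1 + 4 * (x\<^sup>2 + y\<^sup>2)) = 1 / d - 2 * x"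
    using coset_denominator_pos[of w] assms
    by (auto simp: coset_deriv_def x_y_def cmod_power2 field_simps)
  have im: "2 * y * d\<^sup>2 = d2 \<longleftrightarrow> y = d2 / d\<^sup>2 / 2"
    using assms by (auto simp: field_simps)
  have sq: "1 + 4 * (x\<^sup>2 + y\<^sup>2) = (1 / d - 2 * x)\<^sup>2 \<longleftrightarrow> x = (1 / d - d - (2 * y * d)\<^sup>2 / d) / 4"
  proof -
    have "1 + 4 * (x\<^sup>2 + y\<^sup>2) = (1 / d - 2 * x)\<^sup>2 \<longleftrightarrow> 4 * x / d = 1 / d / d - 1 - 4 * y\<^sup>2"
      by (simp add: power2_eq_square algebra_simps)
    also have "\<dots> \<longleftrightarrow> 4 * x = (1 / d / d - 1 - 4 * y\<^sup>2) * d"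
      using assms by (simp add: divide_eq_eq)
    also have "(1 / d / d - 1 - 4 * y\<^sup>2) * d = 1 / d - d - (2 * y * d)\<^sup>2 / d"
      using assms by (simp add: field_simps power2_eq_square)
    finally show ?thesis by (simp add: eq_divide_eq mult.commute)
  qed
  have nonneg: "1 / d - 2 * x \<ge> 0" if "x = (1 / d - d - (2 * y * d)\<^sup>2 / d) / 4"
  proof -
    define Q where "Q = 1 / d + d + (2 * y * d)\<^sup>2 / d"
    have "1 / d - 2 * x = Q / 2"
      unfolding that Q_def by (simp add: field_simps)
    moreover have "Q > 0"
      unfolding Q_def using assms by (intro add_pos_nonneg add_pos_pos) auto
    ultimately show ?thesis by linarith
  qed
  have "sqrt (1 + 4 * (x\<^sup>2 + y\<^sup>2)) = 1 / d - 2 * x \<longleftrightarrow> x = (1 / d - d - (2 * y * d)\<^sup>2 / d) / 4" (is "?L \<longleftrightarrow> ?R")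
  proof
    assume L: ?L
    have "(sqrt (1 + 4 * (x\<^sup>2 + y\<^sup>2)))\<^sup>2 = 1 + 4 * (x\<^sup>2 + y\<^sup>2)"
      by (simp add: add_nonneg_nonneg)
    with L sq show ?R by simp
  next
    assume R: ?R
    then have "1 + 4 * (x\<^sup>2 + y\<^sup>2) = (1 / d - 2 * x)\<^sup>2" using sq by blast
    then show ?L using nonneg[OF R] by (simp only: real_sqrt_abs abs_of_nonneg)
  qed
  moreover have "2 * y * d = d2 / d" if "2 * y * d\<^sup>2 = d2"
    using that assms by (simp add: field_simps power2_eq_square)
  ultimately show ?thesis
    using w im unfolding complex_eq_iff jet_coord_def complex.sel x_y_def[symmetric] by metis
qed

lemma moebius_jet_coord:
  assumes "P \<in> moebius_circle" "z \<in> circle"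
  shows "circle_deriv P z > 0" 
    "coset_coord P * z = jet_coord (circle_deriv P z) (circle_deriv2 P z)"
proof -
  show pos: "circle_deriv P z > 0"
    by (simp only: moebius_derivs(1)[OF assms] coset_deriv_pos)
  show "coset_coord P * z = jet_coord (circle_deriv P z) (circle_deriv2 P z)"
    using moebius_derivs[OF assms] by (intro iffD1[OF jet_coord_iff[OF pos]]) simp
qed

text \<open>
  From \<open>|a|\<^sup>2 - |b|\<^sup>2 = 1\<close> the coordinate determines \<open>|a|\<close>. So the two values of \<open>a\<close>
  differ by a unit scalar, and \<open>b\<close>, determined by \<open>a\<close> and the coordinate, by the same one.
\<close>

lemma same_coord_rotation:
  assumes "P \<in> moebius_circle" "Q \<in> moebius_circle" "coset_coord P = coset_coord Q"
  obtains k where "\<And>z. z \<in> circle \<Longrightarrow> Q z = cis k * P z"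
proof -
  obtain a b where ab: "su11 a b" "P = su11_action a b" using assms(1) by (rule moebius_circleE)
  obtain c d where cd: "su11 c d" "Q = su11_action c d" using assms(2) by (rule moebius_circleE)
  have p: "a * cnj b = c * cnj d"
    using assms(3) ab cd by (simp add: coset_coord_su11)
  have "(norm a)\<^sup>2 + (norm b)\<^sup>2 = (norm c)\<^sup>2 + (norm d)\<^sup>2"
    using su11_sqrt[OF ab(1)] su11_sqrt[OF cd(1)] p by simp
  then have nn: "(norm a)\<^sup>2 = (norm c)\<^sup>2" "(norm a)\<^sup>2 \<ge> 1"
    using ab(1) cd(1) zero_le_power2[of "norm b"] unfolding su11_norm by linarith+
  then have n: "norm a = norm c" "a \<noteq> 0" by auto
  define k where "k = Arg (c / a)"
  have "c / a \<in> circle" using n by (auto simp: norm_divide)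
  then have c: "c = cis k * a"
    using n cis_Arg_circle[of "c / a"] by (simp add: k_def)
  then have "a * cnj b = a * (cis k * cnj d)" using p by simp
  then have "cnj b = cis k * cnj d" using n by simp
  then have "b = cis (- k) * d"
    by (metis complex_cnj_cnj complex_cnj_mult cis_cnj)
  then have "d = cis k * b" by (simp add: mult.assoc[symmetric] cis_mult)
  with c su11_rotate[OF ab(1)] show ?thesis
    by (intro that[of "2 * k"]) (simp add: ab cd)
qed

text \<open>
  The 2-jet at one point determines the coset coordinate, hence the transformation up to a rotation on
  the left.
\<close>

lemma same_jet_rotation:
  assumes "P \<in> moebius_circle" "Q \<in> moebius_circle" "z \<in> circle"
    "circle_deriv P z = circle_deriv Q z" "circle_deriv2 P z = circle_deriv2 Q z"
  obtains k where "\<And>w. w \<in> circle \<Longrightarrow> Q w = cis k * P w"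
proof -
  have "coset_coord P * z = coset_coord Q * z"
    using moebius_jet_coord(2)[OF assms(1,3)] moebius_jet_coord(2)[OF assms(2,3)] assms by simp
  then have "coset_coord P = coset_coord Q" using assms(3) by auto
  from same_coord_rotation[OF assms(1,2) this] that show ?thesis by blast
qed

definition su11_matrix :: "complex \<Rightarrow> complex \<Rightarrow> real^2^2" where
  "su11_matrix a b = (\<chi> i j. if i = 1 then (if j = 1 then Re a + Re b else Im a - Im b)
     else (if j = 1 then - Im a - Im b else Re a - Re b))"

lemma su11_matrix: "SL2R_alpha (su11_matrix a b) = a" "SL2R_beta (su11_matrix a b) = b"
  by (simp_all add: SL2R_alpha_def SL2R_beta_def su11_matrix_def complex_eq_iff)

text \<open>
  Normalizing \<open>a\<close> to be a positive real number picks one element of each coset, and does so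
  continuously.
\<close>

definition coset_section :: "complex \<Rightarrow> complex \<Rightarrow> complex" where
  "coset_section p = (let r = sqrt ((sqrt (1 + 4 * (norm p)\<^sup>2) + 1) / 2) in
     su11_action (of_real r) (cnj p / of_real r))"

lemma coset_section:
  "continuous_map euclidean moebius_topology coset_section" "coset_coord (coset_section p) = p"
proof -
  define r where "r p = sqrt ((sqrt (1 + 4 * (norm p)\<^sup>2) + 1) / 2)" for p :: complex
  have r: "r p > 0" for p
    by (simp add: r_def add_pos_pos add_pos_nonneg add_nonneg_pos)
  have su: "su11 (of_real (r p)) (cnj p / of_real (r p))" for p
  proof -
    define q where "q = sqrt (1 + 4 * (norm p)\<^sup>2)"
    have q: "q > 0" "q\<^sup>2 = 1 + 4 * (norm p)\<^sup>2" by (simp_all add: q_def add_pos_nonneg)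
    have r2: "(r p)\<^sup>2 = (q + 1) / 2" using q by (simp add: r_def q_def)
    have "(norm p)\<^sup>2 / ((q + 1) / 2) = (q - 1) / 2"
      using q by (simp add: field_simps power2_eq_square)
    moreover have "norm (complex_of_real (r p)) = r p" using r[of p] by simp
    ultimately show ?thesis
      unfolding su11_norm norm_divide power_divide complex_mod_cnj by (simp only: r2) (simp add: field_simps)
  qed
  have sec: "coset_section p = su11_action (of_real (r p)) (cnj p / of_real (r p))" for p
    by (simp add: coset_section_def r_def Let_def)
  show "coset_coord (coset_section p) = p"
    using r[of p] by (simp add: sec coset_coord_su11[OF su])
  define A where "A p = su11_matrix (of_real (r p)) (cnj p / of_real (r p))" for p
  have "coset_section = SL2R_action \<circ> A"
    by (auto simp: sec A_def SL2R_action_su11 su11_matrix)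
  moreover have "continuous_map euclidean (top_of_set SL2R) A"
  proof -
    have r0: "r p \<noteq> 0" for p using r[of p] by simp
    have "continuous_on UNIV r"
      unfolding r_def[abs_def] by (intro continuous_intros) auto
    then have "continuous_on UNIV (\<lambda>p. of_real (r p) :: complex)"
      "continuous_on UNIV (\<lambda>p. cnj p / of_real (r p) :: complex)"
      using r0 by (auto intro!: continuous_intros)
    then have "continuous_on UNIV (\<lambda>p. A p $ i $ j)" for i j
      unfolding A_def su11_matrix_def by (cases "i = 1"; cases "j = 1") (auto intro!: continuous_intros simp: r0)
    then have "continuous_on UNIV (\<lambda>p. \<chi> i j. A p $ i $ j)"
      by (intro continuous_on_vec_lambda)
    then have "continuous_on UNIV A" by (simp add: vec_lambda_eta)
    moreover have "range A \<subseteq> SL2R"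
      using su by (auto simp: A_def su11_SL2R su11_matrix)
    ultimately show ?thesis by (auto simp: continuous_map_in_subtopology)
  qed
  ultimately show "continuous_map euclidean moebius_topology coset_section"
    using continuous_map_compose quotient_imp_continuous_map[OF quotient_map_SL2R_action] by metis
qed

lemma coset_section_moebius: "coset_section p \<in> moebius_circle"
  using continuous_map_funspace[OF coset_section(1)] by (auto simp: topspace_moebius_topology)

section \<open>Reducibility as an invariance equation for 2-jets\<close>

lemma moebius_circle_C2: "P \<in> moebius_circle \<Longrightarrow> circle_C2 P"
  using moebius_C2_lift circle_C2_iff by metis

lemma moebius_jet_of_coord:
  assumes P: "P \<in> moebius_circle" and z: "z \<in> circle" and d: "d > 0"
    and p: "coset_coord P * z = jet_coord d d2"
  shows "circle_deriv P z = d" "circle_deriv2 P z = d2"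
proof -
  have "coset_deriv (jet_coord d d2) = d \<and> 2 * Im (jet_coord d d2) * d\<^sup>2 = d2"
    using jet_coord_iff[OF d] by blast
  then show "circle_deriv P z = d" "circle_deriv2 P z = d2"
    using moebius_derivs[OF P z] p by simp_all
qed

lemma moebius_with_jet:
  assumes z: "z \<in> circle" and w: "w \<in> circle" and d: "d > 0"
  obtains P where "P \<in> moebius_circle" "P z = w" "circle_deriv P z = d" "circle_deriv2 P z = d2"
proof -
  define p where "p = jet_coord d d2 / z"
  obtain a b where ab: "su11 a b" "coset_section p = su11_action a b"
    using coset_section_moebius by (rule moebius_circleE)
  have p: "a * cnj b = p"
    using coset_section(2)[of p] coset_coord_su11[OF ab(1)] ab(2) by simp
  define u where "u = su11_action a b z"
  have u: "u \<in> circle" using su11_action_circle[OF ab(1) z] by (simp add: u_def)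
  \<comment> \<open>Multiplying \<open>a\<close> and \<open>b\<close> by \<open>cis k\<close> rotates the image by the angle \<open>2 k\<close>.\<close>
  define k where "k = Arg (w / u) / 2"
  define P where "P = su11_action (cis k * a) (cis k * b)"
  have P: "P \<in> moebius_circle"
    unfolding P_def by (intro su11_action_in_moebius su11_rotate(1) ab(1))
  have "w / u \<in> circle" using u w by (simp add: norm_divide)
  then have "cis (2 * k) * u = w"
    using u cis_Arg_circle[of "w / u"] by (auto simp: k_def)
  then have Pz: "P z = w"
    by (simp add: P_def su11_rotate(2)[OF ab(1) z] u_def)
  have "coset_coord P = cis k * a * cnj (cis k * b)"
    unfolding P_def by (rule coset_coord_su11[OF su11_rotate(1)[OF ab(1)]])
  also have "\<dots> = (cis k * cnj (cis k)) * (a * cnj b)"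
    by (simp add: mult_ac)
  also have "\<dots> = p"
    using circle_cnj[of "cis k"] p by simp
  finally have "coset_coord P * z = jet_coord d d2"
    using z by (auto simp: p_def)
  from moebius_jet_of_coord[OF P z d this] that P Pz show ?thesis by blast
qed

text \<open>
  A Moebius transformation with the given derivatives exists by \<open>jet_coord\<close>, and a rotation on the
  left adjusts its value. Uniqueness holds because a rotation with a fixed point is trivial.
\<close>

lemma projective_derivative:
  assumes f: "circle_C2 f" and z: "z \<in> circle" and pos: "circle_deriv f z > 0"
  defines "P \<equiv> projective_derivative f z"
  shows "P \<in> moebius_circle" "P z = f z"
    "circle_deriv P z = circle_deriv f z" "circle_deriv2 P z = circle_deriv2 f z"
proof -
  let ?is = "\<lambda>P. P \<in> moebius_circle \<and> P z = f z
     \<and> circle_deriv P z = circle_deriv f z \<and> circle_deriv2 P z = circle_deriv2 f z"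
  obtain Q where Q: "?is Q"
    using moebius_with_jet[OF z circle_C2_range[OF f z] pos, of "circle_deriv2 f z"] by metis
  have "R = Q" if R: "?is R" for R
  proof -
    obtain k where k: "\<And>w. w \<in> circle \<Longrightarrow> R w = cis k * Q w"
      using same_jet_rotation[of Q R z] Q R z by auto
    have "f z = cis k * f z" using k[OF z] Q R by simp
    moreover have "f z \<noteq> 0" using circle_C2_range[OF f z] by auto
    ultimately have "cis k = 1" by simp
    with k have "R w = Q w" if "w \<in> circle" for w using that by simp
    moreover have "R \<in> extensional circle" "Q \<in> extensional circle"
      using Q R moebius_Bij Bij_imp_extensional by blast+
    ultimately show ?thesis by (intro extensionalityI)
  qed
  then have "?is P"
    unfolding P_def projective_derivative_def by (intro theI[of ?is, OF Q])
  then show "P \<in> moebius_circle" "P z = f z"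
    "circle_deriv P z = circle_deriv f z" "circle_deriv2 P z = circle_deriv2 f z" by blast+
qed

lemma rotations_iff:
  assumes X: "X \<in> Bij circle" and Y: "Y \<in> Bij circle" and Z: "Z \<in> Bij circle"
  shows "X \<otimes>\<^bsub>BijGroup circle\<^esub> Y \<otimes>\<^bsub>BijGroup circle\<^esub> inv\<^bsub>BijGroup circle\<^esub> Z \<in> rotations \<longleftrightarrow>
    (\<exists>k. \<forall>z\<in>circle. X (Y z) = cis k * Z z)"
proof -
  have bij: "bij_betw Z circle circle" using Z by (simp add: Bij_def)
  define V where "V = restrict (inv_into circle Z) circle"
  have V: "V \<in> Bij circle" using Z by (simp add: V_def restrict_inv_into_Bij)
  have VZ: "V (Z z) = z" "Z z \<in> circle" if "z \<in> circle" for z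
    using that bij bij_betw_inv_into_left[OF bij that] bij_betwE[OF bij] by (auto simp: V_def)
  have ZV: "Z (V z) = z" "V z \<in> circle" if "z \<in> circle" for z
    using that bij_betw_inv_into_right[OF bij that] Bij_inv_into_mem[OF Z that] by (auto simp: V_def)
  have eq: "X \<otimes>\<^bsub>BijGroup circle\<^esub> Y \<otimes>\<^bsub>BijGroup circle\<^esub> inv\<^bsub>BijGroup circle\<^esub> Z =
      restrict (\<lambda>w. X (Y (V w))) circle"
    unfolding inv_BijGroup[OF Z] V_def[symmetric] using X Y V compose_Bij[OF X Y] ZV
    by (auto simp: BijGroup_def compose_def)
  show ?thesis
    unfolding eq
  proof
    assume "restrict (\<lambda>w. X (Y (V w))) circle \<in> rotations"
    then obtain k where k: "restrict (\<lambda>w. X (Y (V w))) circle = restrict (\<lambda>z. cis k * z) circle"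
      by (auto simp: rotations_def)
    have "X (Y z) = cis k * Z z" if "z \<in> circle" for z
      using fun_cong[OF k, of "Z z"] VZ[OF that] by simp
    then show "\<exists>k. \<forall>z\<in>circle. X (Y z) = cis k * Z z" by blast
  next
    assume "\<exists>k. \<forall>z\<in>circle. X (Y z) = cis k * Z z"
    then obtain k where k: "\<forall>z\<in>circle. X (Y z) = cis k * Z z" by blast
    have "restrict (\<lambda>w. X (Y (V w))) circle = restrict (\<lambda>z. cis k * z) circle"
      using k ZV by (intro restrict_ext) simp
    then show "restrict (\<lambda>w. X (Y (V w))) circle \<in> rotations"
      by (auto simp: rotations_def)
  qed
qed

text \<open>
  By \<open>same_jet_rotation\<close> it suffices to compare the 2-jets of \<open>M P\<close> and \<open>N\<close> at \<open>z\<close>, and the chain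
  rule computes the former.
\<close>

lemma moebius_rotation_iff_jets:
  assumes M: "M \<in> moebius_circle" and P: "P \<in> moebius_circle" and N: "N \<in> moebius_circle"
    and z: "z \<in> circle"
  shows "M \<otimes>\<^bsub>BijGroup circle\<^esub> P \<otimes>\<^bsub>BijGroup circle\<^esub> inv\<^bsub>BijGroup circle\<^esub> N \<in> rotations \<longleftrightarrow>
    circle_deriv M (P z) * circle_deriv P z = circle_deriv N z \<and>
    circle_deriv2 M (P z) * (circle_deriv P z)\<^sup>2 + circle_deriv M (P z) * circle_deriv2 P z = circle_deriv2 N z"
    (is "_ \<longleftrightarrow> ?jets")
proof -
  let ?C = "compose circle M P"
  note C = circle_derivs_compose[OF moebius_circle_C2[OF P] moebius_circle_C2[OF M] z]
  have "(\<exists>k. \<forall>w\<in>circle. M (P w) = cis k * N w) \<longleftrightarrow>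
    circle_deriv ?C z = circle_deriv N z \<and> circle_deriv2 ?C z = circle_deriv2 N z"
  proof
    assume "\<exists>k. \<forall>w\<in>circle. M (P w) = cis k * N w"
    then obtain k where "\<forall>w\<in>circle. M (P w) = cis k * N w" by blast
    then have k: "?C w = cis k * N w" if "w \<in> circle" for w using that by (simp add: compose_eq)
    from circle_derivs_rotate[OF moebius_circle_C2[OF N] z k]
    show "circle_deriv ?C z = circle_deriv N z \<and> circle_deriv2 ?C z = circle_deriv2 N z" by blast
  next
    assume "circle_deriv ?C z = circle_deriv N z \<and> circle_deriv2 ?C z = circle_deriv2 N z"
    then have jets: "circle_deriv N z = circle_deriv ?C z" "circle_deriv2 N z = circle_deriv2 ?C z"
      by simp_all
    have "\<exists>k. \<forall>w\<in>circle. ?C w = cis k * N w"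
      by (rule same_jet_rotation[OF N moebius_compose[OF M P] z jets]) blast
    then obtain k where k: "\<forall>w\<in>circle. ?C w = cis k * N w" by blast
    have "M (P w) = cis k * N w" if "w \<in> circle" for w
      using bspec[OF k that] compose_eq[OF that, of M P] by simp
    then show "\<exists>k. \<forall>w\<in>circle. M (P w) = cis k * N w" by blast
  qed
  then show ?thesis
    by (simp only: C rotations_iff[OF moebius_Bij[OF M] moebius_Bij[OF P] moebius_Bij[OF N]])
qed

text \<open>
  The chain rule says that this holds for \<open>b = \<phi>'\<close>, \<open>b2 = \<phi>''\<close> if \<open>\<phi> \<circ> f\<close> and \<open>\<phi>\<close>
  differ by a rotation, but \<open>b2\<close> is not required to be the derivative of \<open>b\<close>.
\<close>

definition jet_invariant :: "(complex \<Rightarrow> complex) \<Rightarrow> (complex \<Rightarrow> real) \<Rightarrow> (complex \<Rightarrow> real) \<Rightarrow> bool" where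
  "jet_invariant f b b2 \<longleftrightarrow> (\<forall>z\<in>circle. b (f z) * circle_deriv f z = b z \<and>
     b2 (f z) * (circle_deriv f z)\<^sup>2 + b (f z) * circle_deriv2 f z = b2 z)"

text \<open>
  From left to right, \<open>b\<close> and \<open>b2\<close> are the derivatives of \<open>B(z)\<close> at \<open>z\<close>. They are continuous because
  they depend on \<open>z\<close> and on the coset coordinate only, which is continuous on the Moebius group. From
  right to left, \<open>B(z)\<close> is the chosen element of the coset that has the prescribed 2-jet at \<open>z\<close>.
\<close>

lemma SO2_reducible_iff_jets:
  assumes C2: "\<And>f. f \<in> \<Gamma> \<Longrightarrow> circle_C2 f"
    and pos: "\<And>f z. f \<in> \<Gamma> \<Longrightarrow> z \<in> circle \<Longrightarrow> circle_deriv f z > 0"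
  shows "SO2_reducible \<Gamma> \<longleftrightarrow> (\<exists>b b2. continuous_on circle b \<and> continuous_on circle b2 \<and>
    (\<forall>z\<in>circle. b z > 0) \<and> (\<forall>f\<in>\<Gamma>. jet_invariant f b b2))"
proof -
  have key: "(\<forall>z\<in>circle. B (f z) \<otimes>\<^bsub>BijGroup circle\<^esub> projective_derivative f z
          \<otimes>\<^bsub>BijGroup circle\<^esub> inv\<^bsub>BijGroup circle\<^esub> (B z) \<in> rotations) \<longleftrightarrow>
      jet_invariant f (\<lambda>z. circle_deriv (B z) z) (\<lambda>z. circle_deriv2 (B z) z)"
    if B: "\<And>z. z \<in> circle \<Longrightarrow> B z \<in> moebius_circle" and f: "f \<in> \<Gamma>" for B f
    unfolding jet_invariant_def
  proof (rule ball_cong[OF refl])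
    fix z assume z: "z \<in> circle"
    note P = projective_derivative[OF C2[OF f] z pos[OF f z]]
    show "B (f z) \<otimes>\<^bsub>BijGroup circle\<^esub> projective_derivative f z
          \<otimes>\<^bsub>BijGroup circle\<^esub> inv\<^bsub>BijGroup circle\<^esub> (B z) \<in> rotations \<longleftrightarrow>
      circle_deriv (B (f z)) (f z) * circle_deriv f z = circle_deriv (B z) z \<and>
      circle_deriv2 (B (f z)) (f z) * (circle_deriv f z)\<^sup>2 + circle_deriv (B (f z)) (f z) * circle_deriv2 f z
        = circle_deriv2 (B z) z"
      using moebius_rotation_iff_jets[OF B[OF circle_C2_range[OF C2[OF f] z]] P(1) B[OF z] z]
      by (simp only: P(2-4))
  qed
  show ?thesis
  proof
    assume "SO2_reducible \<Gamma>"
    then obtain B where B: "continuous_map (top_of_set circle) moebius_topology B"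
      and red: "\<forall>f\<in>\<Gamma>. \<forall>z\<in>circle. B (f z) \<otimes>\<^bsub>BijGroup circle\<^esub> projective_derivative f z
          \<otimes>\<^bsub>BijGroup circle\<^esub> inv\<^bsub>BijGroup circle\<^esub> (B z) \<in> rotations"
      unfolding SO2_reducible_def by blast
    have Bm: "B z \<in> moebius_circle" if "z \<in> circle" for z
      using continuous_map_funspace[OF B] that by (auto simp: topspace_moebius_topology)
    define b where "b z = circle_deriv (B z) z" for z
    define b2 where "b2 z = circle_deriv2 (B z) z" for z
    have "continuous_on circle (\<lambda>z. coset_coord (B z))"
      using continuous_map_compose[OF B continuous_map_coset_coord] by (simp add: o_def)
    then have p: "continuous_on circle (\<lambda>z. coset_coord (B z) * z)"
      by (intro continuous_intros)
    have b: "b z = coset_deriv (coset_coord (B z) * z)" if "z \<in> circle" for z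
      using moebius_derivs(1)[OF Bm[OF that] that] by (simp add: b_def)
    have "continuous_on circle (\<lambda>z. coset_deriv (coset_coord (B z) * z))"
      unfolding coset_deriv_def
      by (intro continuous_intros p ballI less_imp_neq[OF coset_denominator_pos, symmetric])
    then have cb: "continuous_on circle b"
      by (rule continuous_on_eq) (simp add: b)
    have "continuous_on circle (\<lambda>z. 2 * Im (coset_coord (B z) * z) * (b z)\<^sup>2)"
      by (intro continuous_intros p cb)
    then have cb2: "continuous_on circle b2"
      by (rule continuous_on_eq) (simp only: b_def b2_def moebius_derivs(2)[OF Bm])
    have "\<forall>z\<in>circle. b z > 0" using b coset_deriv_pos by simp
    moreover have "jet_invariant f b b2" if f: "f \<in> \<Gamma>" for f
      unfolding b_def b2_def using iffD1[OF key[of B f, OF Bm f]] red f by blast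
    ultimately show "\<exists>b b2. continuous_on circle b \<and> continuous_on circle b2 \<and>
        (\<forall>z\<in>circle. b z > 0) \<and> (\<forall>f\<in>\<Gamma>. jet_invariant f b b2)"
      using cb cb2 by blast
  next
    assume "\<exists>b b2. continuous_on circle b \<and> continuous_on circle b2 \<and>
        (\<forall>z\<in>circle. b z > 0) \<and> (\<forall>f\<in>\<Gamma>. jet_invariant f b b2)"
    then obtain b b2 where cb: "continuous_on circle b" and cb2: "continuous_on circle b2"
      and bpos: "\<And>z. z \<in> circle \<Longrightarrow> b z > 0" and inv: "\<forall>f\<in>\<Gamma>. jet_invariant f b b2" by blast
    define p where "p z = jet_coord (b z) (b2 z) / z" for z
    define B where "B z = coset_section (p z)" for z
    have b0: "b z \<noteq> 0" "z \<noteq> 0" if "z \<in> circle" for z using bpos[OF that] that by auto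
    have "continuous_on circle p"
      unfolding p_def[abs_def] jet_coord_def Complex_eq
      using b0 by (intro continuous_intros cb cb2) auto
    then have "continuous_map (top_of_set circle) euclidean p" by simp
    from continuous_map_compose[OF this coset_section(1)]
    have Bc: "continuous_map (top_of_set circle) moebius_topology B"
      by (simp add: B_def[abs_def] o_def)
    have Bm: "B z \<in> moebius_circle" for z by (simp add: B_def coset_section_moebius)
    have jets: "circle_deriv (B z) z = b z" "circle_deriv2 (B z) z = b2 z" if z: "z \<in> circle" for z
    proof -
      have "coset_coord (B z) * z = jet_coord (b z) (b2 z)"
        using b0[OF z] by (simp add: B_def coset_section(2) p_def)
      then show "circle_deriv (B z) z = b z" "circle_deriv2 (B z) z = b2 z"
        using moebius_jet_of_coord[OF Bm z bpos[OF z]] by blast+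
    qed
    have "jet_invariant f (\<lambda>z. circle_deriv (B z) z) (\<lambda>z. circle_deriv2 (B z) z)" if "f \<in> \<Gamma>" for f
      using inv that jets circle_C2_range[OF C2[OF that]] unfolding jet_invariant_def by simp
    then show "SO2_reducible \<Gamma>"
      unfolding SO2_reducible_def using Bc iffD2[OF key[of B, OF Bm]] by blast
  qed
qed

lemma diffeo_conjugates_iff:
  assumes "\<phi> \<in> circle_diffeos" "f \<in> circle_diffeos"
  shows "\<phi> \<otimes>\<^bsub>BijGroup circle\<^esub> f \<otimes>\<^bsub>BijGroup circle\<^esub> inv\<^bsub>BijGroup circle\<^esub> \<phi> \<in> rotations \<longleftrightarrow>
    (\<exists>k. \<forall>z\<in>circle. \<phi> (f z) = cis k * \<phi> z)"
proof -
  have "\<phi> \<in> Bij circle" "f \<in> Bij circle" using assms by (simp_all add: circle_diffeos_def)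
  then show ?thesis by (rule rotations_iff[OF _ _ \<open>\<phi> \<in> Bij circle\<close>])
qed

lemma conjugacy_jet_invariant:
  assumes \<phi>: "circle_C2 \<phi>" and f: "circle_C2 f"
    and k: "\<And>z. z \<in> circle \<Longrightarrow> \<phi> (f z) = cis k * \<phi> z"
  shows "jet_invariant f (circle_deriv \<phi>) (circle_deriv2 \<phi>)"
  unfolding jet_invariant_def
proof
  fix z assume z: "z \<in> circle"
  show "circle_deriv \<phi> (f z) * circle_deriv f z = circle_deriv \<phi> z \<and>
     circle_deriv2 \<phi> (f z) * (circle_deriv f z)\<^sup>2 + circle_deriv \<phi> (f z) * circle_deriv2 f z = circle_deriv2 \<phi> z"
    using circle_derivs_compose[OF f \<phi> z] circle_derivs_rotate[OF \<phi> z, of "compose circle \<phi> f" k] k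
    by (simp add: compose_eq)
qed

section \<open>A diffeomorphism from an invariant field of 2-jets\<close>

text \<open>
  The diffeomorphism is the integral of a density \<open>exp E\<close> whose logarithmic derivative is
  \<open>b2 / b\<close> corrected by a constant multiple of \<open>b\<close>. The correction preserves invariance because
  \<open>b\<close> is an invariant density, and makes \<open>E\<close> periodic. It depends on \<open>b\<close> and \<open>b2\<close> only, so a single
  diffeomorphism serves all \<open>f\<close> at once.
\<close>

lemma jet_field_linearizes:
  assumes b: "continuous_on circle b" and b2: "continuous_on circle b2"
    and pos: "\<And>z. z \<in> circle \<Longrightarrow> b z > 0"
  obtains \<phi> where "\<phi> \<in> circle_diffeos"
    "\<And>f. f \<in> circle_diffeos \<Longrightarrow> jet_invariant f b b2 \<Longrightarrow> \<exists>k. \<forall>z\<in>circle. \<phi> (f z) = cis k * \<phi> z"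
proof -
  define u where "u t = b (cis t)" for t
  define v where "v t = b2 (cis t) / b (cis t)" for t
  have u: "u t > 0" for t by (simp add: u_def pos)
  have cu: "continuous_on UNIV u"
    unfolding u_def by (rule continuous_on_compose2[OF b]) (auto intro: continuous_intros)
  have "continuous_on UNIV (\<lambda>t. b2 (cis t))"
    by (rule continuous_on_compose2[OF b2]) (auto intro: continuous_intros)
  then have cv: "continuous_on UNIV v"
    unfolding v_def using cu u by (intro continuous_on_divide) (auto simp: u_def less_imp_neq[symmetric])
  have per: "u (t + 2 * pi) = u t" "v (t + 2 * pi) = v t" for t
    by (simp_all add: u_def v_def cis_add_2pi)
  obtain U where U: "\<And>t. (U has_real_derivative u t) (at t)" using antiderivative_real[OF cu] by blast
  obtain V where V: "\<And>t. (V has_real_derivative v t) (at t)" using antiderivative_real[OF cv] by blast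
  have dU: "U (2 * pi) - U 0 > 0"
    using DERIV_pos_imp_increasing[of 0 "2 * pi" U] U u by auto
  \<comment> \<open>The constant for which \<open>v + a u\<close> has integral zero over a period.\<close>
  define a where "a = - (V (2 * pi) - V 0) / (U (2 * pi) - U 0)"
  define e where "e t = v t + a * u t" for t
  define E where "E t = V t + a * U t" for t
  have E: "(E has_real_derivative e t) (at t)" for t
    unfolding E_def e_def by (auto intro!: derivative_eq_intros U V)
  have perE: "E (t + 2 * pi) = E t" for t
  proof -
    have "E (t + 2 * pi) - E t = (V (2 * pi) - V 0) + a * (U (2 * pi) - U 0)"
      unfolding deriv_shift_diff_const[OF U per(1), of t, symmetric]
        deriv_shift_diff_const[OF V per(2), of t, symmetric] E_def by (simp add: algebra_simps)
    also have "\<dots> = 0" using dU by (simp add: a_def)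
    finally show ?thesis by simp
  qed
  have cE: "continuous_on UNIV E"
    using E DERIV_isCont by (blast intro: continuous_at_imp_continuous_on)
  then obtain M where M: "\<And>t. (M has_real_derivative exp (E t)) (at t)"
    using antiderivative_real[of "\<lambda>t. exp (E t)"] by (auto intro: continuous_intros)
  define s where "s = 2 * pi / (M (2 * pi) - M 0)"
  have dM: "M (2 * pi) - M 0 > 0"
    using DERIV_pos_imp_increasing[of 0 "2 * pi" M] M exp_gt_zero by fastforce
  then have s: "s > 0" by (simp add: s_def)
  define \<Phi> where "\<Phi> t = s * M t" for t
  define \<Phi>' where "\<Phi>' t = s * exp (E t)" for t
  have d: "(\<Phi> has_real_derivative \<Phi>' t) (at t)" for t
    unfolding \<Phi>_def \<Phi>'_def by (auto intro!: derivative_eq_intros M)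
  have d2: "(\<Phi>' has_real_derivative s * exp (E t) * e t) (at t)" for t
    unfolding \<Phi>'_def by (auto intro!: derivative_eq_intros E)
  have c2: "continuous_on UNIV (\<lambda>t. s * exp (E t) * e t)"
    unfolding e_def by (intro continuous_intros cE cu cv)
  have \<Phi>'_pos: "\<Phi>' t > 0" for t using s by (simp add: \<Phi>'_def)
  have per\<Phi>: "\<Phi> (t + 2 * pi) = \<Phi> t + 2 * pi" for t
  proof -
    have "M (t + 2 * pi) - M t = M (2 * pi) - M 0"
      using deriv_shift_diff_const[OF M] perE by simp
    then have "\<Phi> (t + 2 * pi) - \<Phi> t = s * (M (2 * pi) - M 0)"
      by (simp add: \<Phi>_def flip: right_diff_distrib)
    then show ?thesis using dM by (simp add: s_def)
  qed
  define \<phi> where "\<phi> = circle_map_of \<Phi>"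
  have \<phi>: "\<phi> (cis t) = cis (\<Phi> t)" for t
    unfolding \<phi>_def by (rule circle_map_of_cis[of \<Phi>, OF per\<Phi>])
  show ?thesis
  proof (rule that[of \<phi>])
    show "\<phi> \<in> circle_diffeos"
      unfolding \<phi>_def by (rule diffeo_from_lift[OF d d2 c2 \<Phi>'_pos per\<Phi>])
    fix f assume f: "f \<in> circle_diffeos" and inv: "jet_invariant f b b2"
    obtain F F' F'' where F: "C2_lift F F' F'' f"
      using f circle_C2_iff by (auto simp: circle_diffeos_def)
    have lift: "is_lift F f" using F by (simp add: C2_lift_def)
    note F'_pos = diffeo_deriv_pos(2)[OF f F]
    have dF: "(F has_real_derivative F' t) (at t)" "(F' has_real_derivative F'' t) (at t)" for t
      using F by (simp_all add: C2_lift_def)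
    have inv: "u (F t) * F' t = u t" "v (F t) * F' t + F'' t / F' t = v t" for t
    proof -
      have "f (cis t) = cis (F t)" by (rule is_lift_cis[OF lift])
      then have i: "u (F t) * F' t = u t"
        "b2 (cis (F t)) * (F' t)\<^sup>2 + u (F t) * F'' t = b2 (cis t)"
        using bspec[OF inv[unfolded jet_invariant_def], of "cis t"] C2_lift_derivs[OF F, of t]
        by (simp_all add: u_def)
      then show "u (F t) * F' t = u t" by simp
      have "v t = (b2 (cis (F t)) * (F' t)\<^sup>2 + u (F t) * F'' t) / (u (F t) * F' t)"
        using i by (simp add: v_def u_def)
      also have "\<dots> = v (F t) * F' t + F'' t / F' t"
        using u[of "F t"] F'_pos[of t] by (simp add: v_def u_def field_simps power2_eq_square)
      finally show "v (F t) * F' t + F'' t / F' t = v t" by simp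
    qed
    \<comment> \<open>The function is the logarithm of the ratio of the pulled back density to the density itself.\<close>
    have "((\<lambda>t. E (F t) + ln (F' t) - E t) has_real_derivative 0) (at t)" for t
    proof -
      have "((\<lambda>t. E (F t) + ln (F' t) - E t) has_real_derivative e (F t) * F' t + F'' t / F' t - e t) (at t)"
        using F'_pos[of t] by (auto intro!: derivative_eq_intros DERIV_chain2[OF E] E dF)
      moreover have "e (F t) * F' t + F'' t / F' t - e t = 0"
        unfolding e_def inv(1)[of t, symmetric] inv(2)[of t, symmetric] by (simp add: algebra_simps)
      ultimately show ?thesis by simp
    qed
    then have const: "E (F t) + ln (F' t) - E t = E (F 0) + ln (F' 0) - E 0" for t
      using zero_deriv_const[of "\<lambda>t. E (F t) + ln (F' t) - E t"] by blast
    define K where "K = E (F 0) + ln (F' 0) - E 0"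
    have "E (F t) + ln (F' t) = K + E t" for t
      using const[of t] by (simp add: K_def)
    then have "exp (E (F t) + ln (F' t)) = exp (K + E t)" for t by simp
    then have "exp (E (F t)) * F' t = exp K * exp (E t)" for t
      using F'_pos[of t] by (metis exp_add exp_ln)
    then have density: "\<Phi>' (F t) * F' t = exp K * \<Phi>' t" for t
      by (simp add: \<Phi>'_def mult_ac)
    have "((\<lambda>t. \<Phi> (F t) - exp K * \<Phi> t) has_real_derivative 0) (at t)" for t
      using DERIV_diff[OF DERIV_chain2[OF d dF(1)[of t]] DERIV_cmult[OF d[of t], of "exp K"]] density[of t]
      by simp
    then have const: "\<Phi> (F t) - exp K * \<Phi> t = \<Phi> (F 0) - exp K * \<Phi> 0" for t
      using zero_deriv_const[of "\<lambda>t. \<Phi> (F t) - exp K * \<Phi> t"] by blast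
    \<comment> \<open>Increment over one period: \<open>F\<close> and \<open>\<Phi>\<close> both advance by \<open>2 \<pi>\<close>.\<close>
    have "exp K * (2 * pi) = 2 * pi"
      using const[of "0 + 2 * pi"] diffeo_degree_one[OF f lift diffeo_deriv_pos(1)[OF f F], of 0]
        per\<Phi>[of 0] per\<Phi>[of "F 0"] by (simp add: algebra_simps)
    then have "exp K = 1" by simp
    then have shift: "\<Phi> (F t) = (\<Phi> (F 0) - \<Phi> 0) + \<Phi> t" for t
      using const[of t] by simp
    have rot: "\<phi> (f (cis t)) = cis (\<Phi> (F 0) - \<Phi> 0) * \<phi> (cis t)" for t
      unfolding is_lift_cis[OF lift] \<phi> cis_mult by (rule arg_cong[OF shift])
    show "\<exists>k. \<forall>z\<in>circle. \<phi> (f z) = cis k * \<phi> z"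
    proof (intro exI ballI)
      fix z assume "z \<in> circle"
      then obtain t where "z = cis t" by (rule circle_cisE)
      then show "\<phi> (f z) = cis (\<Phi> (F 0) - \<Phi> 0) * \<phi> z" using rot by simp
    qed
  qed
qed

theorem theoremA:
  fixes \<Gamma> :: "(complex \<Rightarrow> complex) set"
  assumes "subgroup \<Gamma> (BijGroup circle)"
    and "\<Gamma> \<subseteq> circle_diffeos"
  shows "SO2_reducible \<Gamma> \<longleftrightarrow> C2_conjugate_to_rotations \<Gamma>"
proof -
  have C2: "circle_C2 f" if "f \<in> circle_diffeos" for f using that by (simp add: circle_diffeos_def)
  have reducible: "SO2_reducible \<Gamma> \<longleftrightarrow> (\<exists>b b2. continuous_on circle b \<and> continuous_on circle b2 \<and>
    (\<forall>z\<in>circle. b z > 0) \<and> (\<forall>f\<in>\<Gamma>. jet_invariant f b b2))"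
    using assms(2) C2 diffeo_circle_deriv_pos by (intro SO2_reducible_iff_jets) blast+
  have conj: "C2_conjugate_to_rotations \<Gamma> \<longleftrightarrow>
    (\<exists>\<phi>\<in>circle_diffeos. \<forall>f\<in>\<Gamma>. \<exists>k. \<forall>z\<in>circle. \<phi> (f z) = cis k * \<phi> z)"
    unfolding C2_conjugate_to_rotations_def using diffeo_conjugates_iff assms(2) by (meson subsetD)
  show ?thesis
  proof
    assume "SO2_reducible \<Gamma>"
    then obtain b b2 where b: "continuous_on circle b" "continuous_on circle b2"
      "\<And>z. z \<in> circle \<Longrightarrow> b z > 0" and inv: "\<And>f. f \<in> \<Gamma> \<Longrightarrow> jet_invariant f b b2"
      using reducible by blast
    obtain \<phi> where "\<phi> \<in> circle_diffeos"
      "\<And>f. f \<in> circle_diffeos \<Longrightarrow> jet_invariant f b b2 \<Longrightarrow> \<exists>k. \<forall>z\<in>circle. \<phi> (f z) = cis k * \<phi> z"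
      using jet_field_linearizes[OF b] by blast
    then show "C2_conjugate_to_rotations \<Gamma>"
      unfolding conj using inv assms(2) by blast
  next
    assume "C2_conjugate_to_rotations \<Gamma>"
    then obtain \<phi> where \<phi>: "\<phi> \<in> circle_diffeos"
      and k: "\<And>f. f \<in> \<Gamma> \<Longrightarrow> \<exists>k. \<forall>z\<in>circle. \<phi> (f z) = cis k * \<phi> z"
      unfolding conj by blast
    have "jet_invariant f (circle_deriv \<phi>) (circle_deriv2 \<phi>)" if "f \<in> \<Gamma>" for f
      using k[OF that] conjugacy_jet_invariant[OF C2[OF \<phi>], of f] C2 assms(2) that by blast
    then show "SO2_reducible \<Gamma>"
      unfolding reducible
      using continuous_circle_derivs[OF C2[OF \<phi>]] diffeo_circle_deriv_pos[OF \<phi>] by blast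
  qed
qed

end
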